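(* Let $\omega^0\in C_c^\infty(\mathbb{R}^+\times\mathbb{R})$, and let $$\phi^0(r,z)=(\partial_r^{-1}\omega^0)(r,z):=-\int_r^\infty \omega^0(\rho,z)\,d\rho ,$$ so that $\omega^0=\partial_r\phi^0$. Then there exists a unique strong solution $\omega\in C^\infty\left([0,T_{max});C_c^\infty(\mathbb{R}^+\times\mathbb{R})\right)$ of the infinite-dimensional vorticity equation $$\partial_t\omega+\phi\,\partial_z\omega+\omega\,\partial_z\phi=0,\qquad \phi=\partial_r^{-1}\omega,$$ with initial data $\omega(\cdot,\cdot,0)=\omega^0$, where $T_{max}\in(0,+\infty]$ is the maximal time of existence. If $\omega^0$ is not identically zero, then there is finite-time blowup with $$T_{max}=\frac{1}{-\inf_{r\in\mathbb{R}^+,\,z\in\mathbb{R}}\partial_z\phi^0(r,z)}<+\infty .$$ Moreover, for all $0\le t<T_{max}$ and all $(r,z)\in\mathbb{R}^+\times\mathbb{R}$ the solution is given by $$\omega(r,z,t)=\frac{\omega^0(r,h(r,z,t))}{1+t\,\partial_y\phi^0(r,h(r,z,t))},$$ where $\partial_y\phi^0$ denotes the derivative of $\phi^0(r,y)$ in its second argument, and $h(r,z,t)=g_{r,t}^{-1}(z)$ is the inverse (back-to-labels map) of the map $g_{r,t}:\mathbb{R}\to\mathbb{R}$, $g_{r,t}(z)=z+\phi^0(r,z)\,t$.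
   Context: $\mathbb{R}^+=[0,+\infty)$. $C_c^\infty(\mathbb{R}^+\times\mathbb{R})$ is the set of functions of $(r,z)$ that are smooth on $[0,\infty)\times\mathbb{R}$ (up to the boundary $r=0$) with support contained in $[0,R]\times[-Z,Z]$ for some $R,Z>0$; no vanishing at $r=0$ is required. The operator $\partial_r^{-1}$ on $C_c^\infty(\mathbb{R}^+\times\mathbb{R})$ is $(\partial_r^{-1}\omega)(r,z)=-\int_r^{\infty}\omega(\rho,z)\,d\rho$, which again lies in $C_c^\infty(\mathbb{R}^+\times\mathbb{R})$. A strong solution of the infinite-dimensional vorticity equation on $[0,T)$ is a function $\omega(r,z,t)$ in $C^\infty([0,T);C_c^\infty(\mathbb{R}^+\times\mathbb{R}))$ (smooth in all variables, compactly supported in $(r,z)$) satisfying $\partial_t\omega+\phi\partial_z\omega+\omega\partial_z\phi=0$ pointwise, with $\phi(\cdot,\cdot,t)=\partial_r^{-1}\omega(\cdot,\cdot,t)$ for each $t$. $T_{max}$ is the supremum of times $T$ for which a strong solution with the given initial data exists on $[0,T)$; finite-time blowup means $T_{max}<+\infty$. *)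

theory Defs
  imports "HOL-Analysis.Analysis"
begin

text \<open>
  Smoothness up to the boundary.  Derivatives are taken within \<open>S\<close>; they are unique for the sets
  used below, which are convex with nonempty interior.  In finite dimensions continuity
  of all directional components of the derivative is continuity of the derivative itself.
\<close>

primrec Ck_on ::
  "nat \<Rightarrow> 'a::euclidean_space set \<Rightarrow> ('a \<Rightarrow> 'b::real_normed_vector) \<Rightarrow> bool" where
  "Ck_on 0 S f \<longleftrightarrow> continuous_on S f"
| "Ck_on (Suc k) S f \<longleftrightarrow>
     f differentiable_on S \<and> (\<forall>v. Ck_on k S (\<lambda>x. frechet_derivative f (at x within S) v))"

definition smooth_on :: "'a::euclidean_space set \<Rightarrow> ('a \<Rightarrow> 'b::real_normed_vector) \<Rightarrow> bool" where
  "smooth_on S f \<longleftrightarrow> (\<forall>k. Ck_on k S f)"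

text \<open>
  Functions on the half-plane are total functions of \<open>r\<close> and \<open>z\<close> whose values at \<open>r < 0\<close> are
  irrelevant.  Since the box is closed, containing the nonzero set is the same as containing
  the support.
\<close>

definition Cc_smooth :: "(real \<Rightarrow> real \<Rightarrow> real) set" where
  "Cc_smooth = {w. smooth_on ({0..} \<times> UNIV) (\<lambda>(r, z). w r z) \<and>
     (\<exists>R>0. \<exists>Z>0. {(r, z). 0 \<le> r \<and> w r z \<noteq> 0} \<subseteq> {0..R} \<times> {-Z..Z})}"

definition dr_inv :: "(real \<Rightarrow> real \<Rightarrow> real) \<Rightarrow> real \<Rightarrow> real \<Rightarrow> real" where
  "dr_inv w r z = - integral {r..} (\<lambda>\<rho>. w \<rho> z)"

definition dz :: "(real \<Rightarrow> real \<Rightarrow> real) \<Rightarrow> real \<Rightarrow> real \<Rightarrow> real" where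
  "dz f r z = deriv (\<lambda>y. f r y) z"

definition times_below :: "ereal \<Rightarrow> real set" where
  "times_below T = {t. 0 \<le> t \<and> ereal t < T}"

text \<open>
  The class \<open>C\<^sup>\<infinity>([0,T); C\<^sub>c\<^sup>\<infinity>)\<close>.  A continuous curve in the inductive limit
  \<open>C\<^sub>c\<^sup>\<infinity>\<close> maps a compact time interval into the functions supported in one common box,
  hence the box may depend on \<open>S < T\<close> but not on the individual time \<open>t \<le> S\<close>.
\<close>

definition smooth_curve_Cc :: "ereal \<Rightarrow> (real \<Rightarrow> real \<Rightarrow> real \<Rightarrow> real) \<Rightarrow> bool" where
  "smooth_curve_Cc T w \<longleftrightarrow>
     smooth_on ({0..} \<times> UNIV \<times> times_below T) (\<lambda>(r, z, t). w r z t) \<and>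
     (\<forall>S\<in>times_below T. \<exists>R>0. \<exists>Z>0. \<forall>t\<in>{0..S}.
        {(r, z). 0 \<le> r \<and> w r z t \<noteq> 0} \<subseteq> {0..R} \<times> {-Z..Z})"

text \<open>The time derivative at \<open>t = 0\<close> is one-sided.\<close>

definition strong_solution ::
  "(real \<Rightarrow> real \<Rightarrow> real) \<Rightarrow> ereal \<Rightarrow> (real \<Rightarrow> real \<Rightarrow> real \<Rightarrow> real) \<Rightarrow> bool" where
  "strong_solution w0 T w \<longleftrightarrow>
     0 < T \<and> smooth_curve_Cc T w \<and>
     (\<forall>r\<ge>0. \<forall>z. w r z 0 = w0 r z) \<and>
     (\<forall>r\<ge>0. \<forall>z. \<forall>t\<in>times_below T.
        let \<omega> = (\<lambda>r z. w r z t); \<phi> = dr_inv \<omega> in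
        vector_derivative (\<lambda>s. w r z s) (at t within times_below T)
          + \<phi> r z * dz \<omega> r z + \<omega> r z * dz \<phi> r z = 0)"

definition T_max :: "(real \<Rightarrow> real \<Rightarrow> real) \<Rightarrow> ereal" where
  "T_max w0 = Sup {T. \<exists>w. strong_solution w0 T w}"

definition flow_map :: "(real \<Rightarrow> real \<Rightarrow> real) \<Rightarrow> real \<Rightarrow> real \<Rightarrow> real \<Rightarrow> real" where
  "flow_map \<phi>0 r t z = z + \<phi>0 r z * t"

definition back_to_labels :: "(real \<Rightarrow> real \<Rightarrow> real) \<Rightarrow> real \<Rightarrow> real \<Rightarrow> real \<Rightarrow> real" where
  "back_to_labels \<phi>0 r z t = inv (flow_map \<phi>0 r t) z"

end

(*
  Integrating the vorticity equation in r turns it into the inviscid Burgers equation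
  phi_t + phi phi_z = 0 for each fixed r.  Hence phi is constant along the lines
  z = y + t phi0(r, y): the difference from its initial value solves a linear homogeneous ODE.
  Differentiating phi(r, y + t phi0(r, y), t) = phi0(r, y) in y excludes 1 + t d_y phi0(r, y) = 0,
  which bounds the lifespan of every solution, and the same identity determines phi and
  therefore omega = d_r phi.  Conversely, as long as the Jacobian 1 + t d_y phi0 is positive the
  back-to-labels map h satisfies a first-order system whose coefficients are smooth functions of
  (r, h, t).  Repeated differentiation therefore stays within smooth functions of (r, h, t), which
  gives smoothness up to r = 0 and t = 0 without an implicit function theorem at the boundary.
*)
theory Submission imports Defs
begin

text \<open>The velocity is an integral over an unbounded ray. Differentiating it requires one
  interval of integration for all nearby points and times, and the common support box on compact
  time intervals provides it. No flow of the unknown velocity has to be constructed: along a line of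
  any constant slope \<open>a\<close> the derivative of \<open>\<Phi>\<close> is
  \<open>(a - \<Phi>) \<Phi>_z\<close>, and choosing for \<open>a\<close> the initial value at the
  starting point makes this linear in \<open>\<Phi> - a\<close>. The lifespan is the first zero of
  \<open>1 + t i\<close>, where \<open>i\<close> is the infimum of the \<open>z\<close>-derivative
  of the initial velocity. An upper bound follows from points with derivative close to
  \<open>i\<close>, each of which has its own time of vanishing Jacobian. Compact support forces
  \<open>i \<le> 0\<close>, strictly for nonzero data. For zero data the division in
  \<open>ereal\<close> yields infinity, so one formula covers both cases and the explicit solution
  always lives on the whole maximal interval.\<close>

section \<open>Smooth functions on sets with boundary\<close>

definition axis_accessible :: "'a::euclidean_space set \<Rightarrow> bool" where
  "axis_accessible S \<longleftrightarrow>
     (\<forall>x\<in>S. \<forall>i\<in>Basis. \<forall>e>0. \<exists>d. 0 < \<bar>d\<bar> \<and> \<bar>d\<bar> < e \<and> x + d *\<^sub>R i \<in> S)"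

lemma axis_accessible_Times:
  assumes "axis_accessible A" "axis_accessible B"
  shows "axis_accessible (A \<times> B)"
  using assms unfolding axis_accessible_def
  by (auto simp: Basis_prod_def)

lemma axis_accessible_real:
  fixes A :: "real set"
  assumes "\<And>x e. x \<in> A \<Longrightarrow> e > 0 \<Longrightarrow> \<exists>y\<in>A. y \<noteq> x \<and> \<bar>y - x\<bar> < e"
  shows "axis_accessible A"
  unfolding axis_accessible_def
proof (intro ballI allI impI)
  fix x i e :: real
  assume "x \<in> A" "i \<in> Basis" "e > 0"
  with assms obtain y where "y \<in> A" "y \<noteq> x" "\<bar>y - x\<bar> < e" by blast
  with \<open>i \<in> Basis\<close> show "\<exists>d. 0 < \<bar>d\<bar> \<and> \<bar>d\<bar> < e \<and> x + d *\<^sub>R i \<in> A"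
    by (intro exI[of _ "y - x"]) auto
qed

lemma axis_accessible_UNIV: "axis_accessible (UNIV :: 'a::euclidean_space set)"
  unfolding axis_accessible_def by (metis UNIV_I abs_of_pos field_lbound_gt_zero)

lemma frechet_derivative_within_eq:
  assumes "axis_accessible S" "x \<in> S" "(f has_derivative D) (at x within S)"
  shows "frechet_derivative f (at x within S) = D"
proof (rule frechet_derivative_unique_within)
  show "(f has_derivative frechet_derivative f (at x within S)) (at x within S)"
    using assms(3) frechet_derivative_works differentiable_def by blast
qed (use assms in \<open>auto simp: axis_accessible_def\<close>)

text \<open>\<open>frechet_derivative\<close> is a choice. Both sides choose from the same set of
  derivatives, so they agree even where that set has several elements.\<close>

lemma frechet_derivative_cong:
  assumes "x \<in> S" "\<And>x. x \<in> S \<Longrightarrow> f x = g x"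
  shows "frechet_derivative f (at x within S) = frechet_derivative g (at x within S)"
proof -
  have "(f has_derivative D) (at x within S) \<longleftrightarrow> (g has_derivative D) (at x within S)" for D
    using has_derivative_transform[of x S f g] has_derivative_transform[of x S g f] assms by metis
  then show ?thesis by (simp add: frechet_derivative_def)
qed

lemma Ck_on_cong:
  assumes "\<And>x. x \<in> S \<Longrightarrow> f x = g x"
  shows "Ck_on k S f \<longleftrightarrow> Ck_on k S g"
  using assms
proof (induction k arbitrary: f g)
  case 0
  then show ?case by (simp cong: continuous_on_cong)
next
  case (Suc k)
  have "f differentiable_on S \<longleftrightarrow> g differentiable_on S"
    unfolding differentiable_on_def differentiable_def
    using Suc.prems has_derivative_transform[of _ S f g] has_derivative_transform[of _ S g f]
    by metis
  moreover have "Ck_on k S (\<lambda>x. frechet_derivative f (at x within S) v) \<longleftrightarrow>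
      Ck_on k S (\<lambda>x. frechet_derivative g (at x within S) v)" for v
    by (rule Suc.IH) (simp add: frechet_derivative_cong[OF _ Suc.prems])
  ultimately show ?case by simp
qed

lemma smooth_on_cong:
  assumes "\<And>x. x \<in> S \<Longrightarrow> f x = g x"
  shows "smooth_on S f \<longleftrightarrow> smooth_on S g"
  by (simp add: smooth_on_def Ck_on_cong[where f = f and g = g, OF assms])

text \<open>Induction on the order, for all members of \<open>X\<close> at once, turns closure under
  one differentiation into smoothness. This replaces formulas for higher derivatives in the closure
  proofs below. Agreement on \<open>S\<close> suffices, so values off \<open>S\<close> are
  free.\<close>

lemma smooth_on_coinduct:
  fixes f :: "'a::euclidean_space \<Rightarrow> 'b::real_normed_vector"
  assumes S: "axis_accessible S" and "X f"
    and step: "\<And>f. X f \<Longrightarrow> \<exists>D. (\<forall>x\<in>S. (f has_derivative D x) (at x within S)) \<and>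
      (\<forall>v. \<exists>g. X g \<and> (\<forall>x\<in>S. D x v = g x))"
  shows "smooth_on S f"
proof -
  have "Ck_on k S f" if "X f" for k f
    using that
  proof (induction k arbitrary: f)
    case 0
    then obtain D where "\<And>x. x \<in> S \<Longrightarrow> (f has_derivative D x) (at x within S)"
      using step by blast
    then have "continuous_on S f" by (rule has_derivative_continuous_on)
    then show ?case by simp
  next
    case (Suc k)
    obtain D where D: "\<And>x. x \<in> S \<Longrightarrow> (f has_derivative D x) (at x within S)"
      and X: "\<And>v. \<exists>g. X g \<and> (\<forall>x\<in>S. D x v = g x)"
      using step[OF Suc.prems] by blast
    have "Ck_on k S (\<lambda>x. frechet_derivative f (at x within S) v)" for v
    proof -
      obtain g where "X g" and g: "\<And>x. x \<in> S \<Longrightarrow> D x v = g x"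
        using X by blast
      have "frechet_derivative f (at x within S) v = g x" if "x \<in> S" for x
        using frechet_derivative_within_eq[OF S that D[OF that]] g[OF that] by simp
      then have "Ck_on k S (\<lambda>x. frechet_derivative f (at x within S) v) \<longleftrightarrow> Ck_on k S g"
        by (rule Ck_on_cong)
      then show ?thesis using Suc.IH[OF \<open>X g\<close>] by simp
    qed
    moreover have "f differentiable_on S"
      using D unfolding differentiable_on_def differentiable_def by blast
    ultimately show ?case by simp
  qed
  with \<open>X f\<close> show ?thesis by (simp add: smooth_on_def)
qed

lemma smooth_on_has_derivative:
  assumes "smooth_on S f" "x \<in> S"
  shows "(f has_derivative frechet_derivative f (at x within S)) (at x within S)"
proof -
  have "Ck_on (Suc 0) S f" using assms(1) by (simp only: smooth_on_def)
  then show ?thesis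
    using assms(2) by (auto simp: differentiable_on_def frechet_derivative_works)
qed

lemma smooth_on_frechet_derivative:
  assumes "smooth_on S f"
  shows "smooth_on S (\<lambda>x. frechet_derivative f (at x within S) v)"
  unfolding smooth_on_def
proof
  fix k
  have "Ck_on (Suc k) S f" using assms by (simp only: smooth_on_def)
  then show "Ck_on k S (\<lambda>x. frechet_derivative f (at x within S) v)" by simp
qed

lemma smooth_on_continuous: "smooth_on S f \<Longrightarrow> continuous_on S f"
  unfolding smooth_on_def using Ck_on.simps(1) by blast

text \<open>The derivative of an affine map is constant, hence affine with linear part 0.\<close>

lemma smooth_on_affine:
  fixes L :: "'a::euclidean_space \<Rightarrow> 'b::real_normed_vector"
  assumes "axis_accessible S" "bounded_linear L"
  shows "smooth_on S (\<lambda>x. L x + c)"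
proof (rule smooth_on_coinduct[where X = "\<lambda>f. \<exists>L c. bounded_linear L \<and> f = (\<lambda>x. L x + c)"])
  fix f :: "'a \<Rightarrow> 'b"
  assume "\<exists>L c. bounded_linear L \<and> f = (\<lambda>x. L x + c)"
  then obtain L c where L: "bounded_linear L" and f: "f = (\<lambda>x. L x + c)" by blast
  have "(f has_derivative L) (at x within S)" for x
    unfolding f using bounded_linear.has_derivative[OF L has_derivative_ident]
    by (auto intro!: derivative_eq_intros)
  moreover have "\<exists>g. (\<exists>L c. bounded_linear L \<and> g = (\<lambda>x. L x + c)) \<and> (\<forall>x\<in>S. L v = g x)" for v
    by (rule exI[of _ "\<lambda>x. L v"]) (auto intro!: exI[of _ "\<lambda>x. 0"])
  ultimately show "\<exists>D. (\<forall>x\<in>S. (f has_derivative D x) (at x within S)) \<and>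
      (\<forall>v. \<exists>g. (\<exists>L c. bounded_linear L \<and> g = (\<lambda>x. L x + c)) \<and> (\<forall>x\<in>S. D x v = g x))"
    by (intro exI[of _ "\<lambda>x. L"]) auto
qed (use assms in auto)

lemma smooth_on_linear:
  fixes L :: "'a::euclidean_space \<Rightarrow> 'b::real_normed_vector"
  shows "axis_accessible S \<Longrightarrow> bounded_linear L \<Longrightarrow> smooth_on S L"
  using smooth_on_affine[of S L 0] by simp

lemma smooth_on_const: "axis_accessible S \<Longrightarrow> smooth_on S (\<lambda>x. c)"
  using smooth_on_affine[of S "\<lambda>x. 0" c] by simp

text \<open>Products and reciprocals are not closed under differentiation separately. Together with
  sums they are, so a single coinduction yields all the arithmetic rules.\<close>

inductive smooth_closure :: "'a::euclidean_space set \<Rightarrow> ('a \<Rightarrow> real) \<Rightarrow> bool" for S where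
  base: "smooth_on S f \<Longrightarrow> smooth_closure S f"
| add: "smooth_closure S f \<Longrightarrow> smooth_closure S g \<Longrightarrow> smooth_closure S (\<lambda>x. f x + g x)"
| mult: "smooth_closure S f \<Longrightarrow> smooth_closure S g \<Longrightarrow> smooth_closure S (\<lambda>x. f x * g x)"
| inverse: "smooth_closure S f \<Longrightarrow> (\<And>x. x \<in> S \<Longrightarrow> f x \<noteq> 0) \<Longrightarrow> smooth_closure S (\<lambda>x. inverse (f x))"

lemma smooth_closure_derivative:
  assumes "axis_accessible S" "smooth_closure S f"
  shows "\<exists>D. (\<forall>x\<in>S. (f has_derivative D x) (at x within S)) \<and> (\<forall>v. smooth_closure S (\<lambda>x. D x v))"
  using assms(2)
proof induction
  case (base f)
  then show ?case
    by (intro exI[of _ "\<lambda>x. frechet_derivative f (at x within S)"])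
       (simp add: smooth_on_has_derivative smooth_on_frechet_derivative smooth_closure.base)
next
  case (add f g)
  then obtain D E where
    D: "\<And>x. x \<in> S \<Longrightarrow> (f has_derivative D x) (at x within S)" "\<And>v. smooth_closure S (\<lambda>x. D x v)"
    and E: "\<And>x. x \<in> S \<Longrightarrow> (g has_derivative E x) (at x within S)" "\<And>v. smooth_closure S (\<lambda>x. E x v)"
    by blast
  show ?case
    by (rule exI[of _ "\<lambda>x v. D x v + E x v"])
       (auto intro!: D E has_derivative_add smooth_closure.add)
next
  case (mult f g)
  then obtain D E where
    D: "\<And>x. x \<in> S \<Longrightarrow> (f has_derivative D x) (at x within S)" "\<And>v. smooth_closure S (\<lambda>x. D x v)"
    and E: "\<And>x. x \<in> S \<Longrightarrow> (g has_derivative E x) (at x within S)" "\<And>v. smooth_closure S (\<lambda>x. E x v)"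
    by blast
  show ?case
    by (rule exI[of _ "\<lambda>x v. f x * E x v + D x v * g x"])
       (auto intro!: D E has_derivative_mult smooth_closure.add smooth_closure.mult mult.hyps)
next
  case (inverse f)
  then obtain D where
    D: "\<And>x. x \<in> S \<Longrightarrow> (f has_derivative D x) (at x within S)" "\<And>v. smooth_closure S (\<lambda>x. D x v)"
    by blast
  \<comment> \<open>The sign is written as a constant factor because the closure has no rule for
    negation.\<close>
  have "smooth_closure S (\<lambda>x. (- 1) * (inverse (f x) * D x v * inverse (f x)))" for v
    using inverse.hyps
    by (intro smooth_closure.mult D smooth_closure.inverse
        smooth_closure.base[OF smooth_on_const[OF assms(1)]])
  then show ?case
    using inverse.hyps
    by (intro exI[of _ "\<lambda>x v. - (inverse (f x) * D x v * inverse (f x))"])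
       (auto intro!: D Deriv.has_derivative_inverse)
qed

lemma smooth_closure_imp_smooth_on:
  assumes S: "axis_accessible S" and f: "smooth_closure S f"
  shows "smooth_on S f"
proof (rule smooth_on_coinduct[OF S, where X = "smooth_closure S"])
  show "\<exists>D. (\<forall>x\<in>S. (f has_derivative D x) (at x within S)) \<and>
      (\<forall>v. \<exists>g. smooth_closure S g \<and> (\<forall>x\<in>S. D x v = g x))"
    if "smooth_closure S f" for f
    using smooth_closure_derivative[OF S that] by blast
qed (fact f)

lemma
  fixes f g :: "'a::euclidean_space \<Rightarrow> real"
  assumes S: "axis_accessible S" and f: "smooth_on S f" and g: "smooth_on S g"
  shows smooth_on_add: "smooth_on S (\<lambda>x. f x + g x)"
    and smooth_on_mult: "smooth_on S (\<lambda>x. f x * g x)"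
  using smooth_closure.base[OF f] smooth_closure.base[OF g]
  by (auto intro!: smooth_closure_imp_smooth_on[OF S] intro: smooth_closure.add smooth_closure.mult)

lemma smooth_on_divide:
  fixes f g :: "'a::euclidean_space \<Rightarrow> real"
  assumes S: "axis_accessible S" and f: "smooth_on S f" and g: "smooth_on S g"
    and "\<And>x. x \<in> S \<Longrightarrow> g x \<noteq> 0"
  shows "smooth_on S (\<lambda>x. f x / g x)"
  unfolding divide_inverse
  by (intro smooth_closure_imp_smooth_on[OF S] smooth_closure.mult smooth_closure.inverse)
     (use assms smooth_closure.base in auto)

lemma smooth_on_minus:
  fixes f :: "'a::euclidean_space \<Rightarrow> real"
  assumes "axis_accessible S" "smooth_on S f"
  shows "smooth_on S (\<lambda>x. - f x)"
  using smooth_on_mult[OF assms(1) smooth_on_const[OF assms(1), of "-1"] assms(2)] by simp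

lemma smooth_on_sum:
  fixes f :: "'i \<Rightarrow> 'a::euclidean_space \<Rightarrow> real"
  assumes "axis_accessible S" "\<And>i. i \<in> I \<Longrightarrow> smooth_on S (f i)"
  shows "smooth_on S (\<lambda>x. \<Sum>i\<in>I. f i x)"
  using assms(2)
  by (induction I rule: infinite_finite_induct)
     (auto intro!: smooth_on_add smooth_on_const assms(1))

text \<open>
  No smoothness of \<open>H\<close> is assumed: \<open>H\<close> solves an autonomous system \<open>DH = P \<circ> H\<close> with smooth
  coefficients, so the functions \<open>Q \<circ> H\<close> with \<open>Q\<close> smooth are closed under differentiation.
\<close>

lemma smooth_on_compose_autonomous:
  fixes H :: "'a::euclidean_space \<Rightarrow> 'b::euclidean_space" and Q :: "'b \<Rightarrow> real"
  assumes A: "axis_accessible A" and B: "axis_accessible B"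
    and maps: "\<And>x. x \<in> A \<Longrightarrow> H x \<in> B"
    and H: "\<And>x. x \<in> A \<Longrightarrow> (H has_derivative (\<lambda>v. P v (H x))) (at x within A)"
    and P: "\<And>v i. i \<in> Basis \<Longrightarrow> smooth_on B (\<lambda>y. P v y \<bullet> i)"
    and Q: "smooth_on B Q"
  shows "smooth_on A (\<lambda>x. Q (H x))"
proof (rule smooth_on_coinduct[OF A, where X = "\<lambda>f. \<exists>Q. smooth_on B Q \<and> f = (\<lambda>x. Q (H x))"])
  fix f :: "'a \<Rightarrow> real"
  assume "\<exists>Q. smooth_on B Q \<and> f = (\<lambda>x. Q (H x))"
  then obtain Q where Q: "smooth_on B Q" and f: "f = (\<lambda>x. Q (H x))" by blast
  define DQ where "DQ y = frechet_derivative Q (at y within B)" for y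
  have DQ: "(Q has_derivative DQ y) (at y within B)" if "y \<in> B" for y
    unfolding DQ_def using smooth_on_has_derivative[OF Q that] .
  have DQs: "smooth_on B (\<lambda>y. DQ y v)" for v
    unfolding DQ_def by (rule smooth_on_frechet_derivative[OF Q])
  have D: "(f has_derivative (\<lambda>v. DQ (H x) (P v (H x)))) (at x within A)" if "x \<in> A" for x
    unfolding f
    by (rule has_derivative_in_compose2[OF DQ])
       (use maps H that in auto)
  \<comment> \<open>Expanding in the basis leaves only real-valued factors, whose sums and products
    are known to be smooth, and exhibits the derivative as a function of \<open>H x\<close>
    again.\<close>
  have sum: "DQ y w = (\<Sum>i\<in>Basis. (w \<bullet> i) * DQ y i)" if "y \<in> B" for y w
  proof -
    have lin: "linear (DQ y)" using DQ[OF that] has_derivative_linear by blast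
    have "DQ y w = DQ y (\<Sum>i\<in>Basis. (w \<bullet> i) *\<^sub>R i)" by (simp add: euclidean_representation)
    also have "\<dots> = (\<Sum>i\<in>Basis. (w \<bullet> i) * DQ y i)"
      by (simp add: linear_sum[OF lin] linear_cmul[OF lin])
    finally show ?thesis .
  qed
  have "smooth_on B (\<lambda>y. \<Sum>i\<in>Basis. (P v y \<bullet> i) * DQ y i)" for v
    by (intro smooth_on_sum smooth_on_mult B P DQs)
  then have "\<exists>g. (\<exists>Q. smooth_on B Q \<and> g = (\<lambda>x. Q (H x))) \<and>
      (\<forall>x\<in>A. DQ (H x) (P v (H x)) = g x)" for v
    using sum[OF maps]
    by (intro exI[of _ "\<lambda>x. \<Sum>i\<in>Basis. (P v (H x) \<bullet> i) * DQ (H x) i"] conjI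
        exI[of _ "\<lambda>y. \<Sum>i\<in>Basis. (P v y \<bullet> i) * DQ y i"] ballI) simp_all
  with D show "\<exists>D. (\<forall>x\<in>A. (f has_derivative D x) (at x within A)) \<and>
      (\<forall>v. \<exists>g. (\<exists>Q. smooth_on B Q \<and> g = (\<lambda>x. Q (H x))) \<and> (\<forall>x\<in>A. D x v = g x))"
    by (intro exI[of _ "\<lambda>x v. DQ (H x) (P v (H x))"] conjI ballI allI)
qed (use Q in \<open>intro exI[of _ Q], simp\<close>)

text \<open>An affine map solves an autonomous system with constant coefficients
  \<open>L v\<close>.\<close>

lemma smooth_on_compose_affine:
  fixes L :: "'a::euclidean_space \<Rightarrow> 'b::euclidean_space" and Q :: "'b \<Rightarrow> real"
  assumes A: "axis_accessible A" and B: "axis_accessible B"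
    and maps: "\<And>x. x \<in> A \<Longrightarrow> L x + c \<in> B" and L: "bounded_linear L"
    and Q: "smooth_on B Q"
  shows "smooth_on A (\<lambda>x. Q (L x + c))"
proof (rule smooth_on_compose_autonomous[OF A B maps _ _ Q, where P = "\<lambda>v y. L v"])
  show "((\<lambda>x. L x + c) has_derivative L) (at x within A)" for x
    using bounded_linear.has_derivative[OF L has_derivative_ident]
    by (auto intro!: derivative_eq_intros)
qed (use smooth_on_const[OF B] in auto)

section \<open>Integration along rays\<close>

text \<open>This is the Leibniz rule on a set that may contain boundary points. The interval of
  integration is the same for all base points, and the rays stay in \<open>U\<close>.\<close>

lemma has_derivative_ray_integral:
  fixes f :: "'a::euclidean_space \<Rightarrow> real"
  assumes "convex U"
    and maps: "\<And>x s. x \<in> U \<Longrightarrow> 0 \<le> s \<Longrightarrow> s \<le> R \<Longrightarrow> x + s *\<^sub>R e \<in> U"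
    and f': "\<And>x. x \<in> U \<Longrightarrow> (f has_derivative f' x) (at x within U)"
    and cont: "\<And>v. continuous_on U (\<lambda>x. f' x v)"
    and "x \<in> U"
  shows "((\<lambda>x. integral {0..R} (\<lambda>s. f (x + s *\<^sub>R e))) has_derivative
      (\<lambda>v. integral {0..R} (\<lambda>s. f' (x + s *\<^sub>R e) v))) (at x within U)"
proof -
  \<comment> \<open>The Leibniz rule expects the derivative as a continuous map into bounded linear
    functions. In finite dimension this follows from continuity of each directional
    component.\<close>
  define F where "F x s = Blinfun (f' (x + s *\<^sub>R e))" for x s
  have F: "blinfun_apply (F x s) = f' (x + s *\<^sub>R e)" if "x \<in> U" "s \<in> {0..R}" for x s
    unfolding F_def using f'[OF maps] that has_derivative_bounded_linear
    by (intro bounded_linear_Blinfun_apply) auto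
  have "((\<lambda>x. f (x + s *\<^sub>R e)) has_derivative blinfun_apply (F x s)) (at x within U)"
    if "x \<in> U" "s \<in> cbox 0 R" for x s
  proof -
    have "((\<lambda>x. x + s *\<^sub>R e) has_derivative (\<lambda>v. v)) (at x within U)"
      by (auto intro!: derivative_eq_intros)
    from has_derivative_in_compose2[of U f f', OF f' _ _ this] that maps
    show ?thesis by (auto simp: F)
  qed
  moreover have "(\<lambda>s. f (x + s *\<^sub>R e)) integrable_on cbox 0 R" if "x \<in> U" for x
  proof (rule integrable_continuous)
    have "continuous_on U f"
      using f' by (rule has_derivative_continuous_on)
    then show "continuous_on (cbox 0 R) (\<lambda>s. f (x + s *\<^sub>R e))"
      by (rule continuous_on_compose2) (use that maps in \<open>auto intro!: continuous_intros\<close>)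
  qed
  moreover have contF: "continuous_on (U \<times> cbox 0 R) (\<lambda>(x, s). F x s)"
  proof (rule continuous_on_blinfun_componentwise)
    fix i :: 'a
    have "continuous_on (U \<times> cbox 0 R) (\<lambda>p. f' (fst p + snd p *\<^sub>R e) i)"
      by (rule continuous_on_compose2[OF cont]) (use maps in \<open>auto intro!: continuous_intros\<close>)
    then show "continuous_on (U \<times> cbox 0 R) (\<lambda>p. blinfun_apply (case p of (x, s) \<Rightarrow> F x s) i)"
      by (rule continuous_on_eq) (auto simp: F)
  qed
  ultimately have "((\<lambda>x. integral (cbox 0 R) (\<lambda>s. f (x + s *\<^sub>R e))) has_derivative
      blinfun_apply (integral (cbox 0 R) (F x))) (at x within U)"
    using \<open>x \<in> U\<close> \<open>convex U\<close> by (intro leibniz_rule) auto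
  moreover
  have "blinfun_apply (integral (cbox 0 R) (F x)) v =
      integral {0..R} (\<lambda>s. f' (x + s *\<^sub>R e) v)" for v
  proof -
    have "continuous_on (cbox 0 R) (F x)"
      using continuous_on_compose2[OF contF, of "cbox 0 R" "\<lambda>s. (x, s)"] \<open>x \<in> U\<close>
      by (simp add: image_subset_iff continuous_on_Pair continuous_on_const continuous_on_id)
    then have "blinfun_apply (integral (cbox 0 R) (F x)) v =
        integral (cbox 0 R) (\<lambda>s. blinfun_apply (F x s) v)"
      by (intro blinfun_apply_integral integrable_continuous)
    also have "\<dots> = integral {0..R} (\<lambda>s. f' (x + s *\<^sub>R e) v)"
      using \<open>x \<in> U\<close> by (auto simp: F intro!: integral_cong)
    finally show ?thesis .
  qed
  then have "blinfun_apply (integral (cbox 0 R) (F x)) = (\<lambda>v. integral {0..R} (\<lambda>s. f' (x + s *\<^sub>R e) v))"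
    by (rule ext)
  ultimately show ?thesis by simp
qed

text \<open>For support in \<open>\<rho> \<le> R\<close> the same \<open>R\<close> serves every
  \<open>r \<ge> 0\<close>, so the improper integral becomes a ray integral over an interval
  independent of \<open>r\<close>.\<close>

lemma dr_inv_eq_integral:
  assumes "\<And>\<rho>. \<rho> > r + R \<Longrightarrow> w \<rho> z = 0"
  shows "dr_inv w r z = - integral {0..R} (\<lambda>s. w (r + s) z)"
proof -
  have "integral {r..} (\<lambda>\<rho>. w \<rho> z) = integral UNIV (\<lambda>\<rho>. if \<rho> \<in> {r..} then w \<rho> z else 0)"
    by (simp only: integral_restrict_UNIV)
  also have "\<dots> = integral UNIV (\<lambda>\<rho>. if \<rho> \<in> {r..r + R} then w \<rho> z else 0)"
    by (intro integral_cong) (auto simp: assms)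
  also have "\<dots> = integral {0 + r..R + r} (\<lambda>\<rho>. w \<rho> z)"
    by (simp only: integral_restrict_UNIV add.commute[of R] add_0_left)
  also have "\<dots> = integral {0..R} (\<lambda>s. w (r + s) z)"
    by (simp only: integral_shift_Icc_real[symmetric] comp_def)
  finally show ?thesis by (simp add: dr_inv_def)
qed

lemma dr_inv_cong:
  "(\<And>\<rho>. \<rho> \<ge> r \<Longrightarrow> w \<rho> z = w' \<rho> z) \<Longrightarrow> dr_inv w r z = dr_inv w' r z"
  unfolding dr_inv_def by (auto intro!: integral_cong)

text \<open>The fundamental theorem on a long interval gives \<open>F M - F r\<close> with
  \<open>F M = 0\<close>, and the minus sign in \<open>dr_inv\<close> leaves \<open>F r\<close>.
  Beyond \<open>M\<close> the integrand vanishes as the derivative of zero.\<close>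

lemma dr_inv_eqI:
  assumes F: "\<And>\<rho>. \<rho> \<ge> r \<Longrightarrow> (F has_real_derivative f \<rho> z) (at \<rho> within {r..})"
    and R: "\<And>\<rho>. \<rho> > R \<Longrightarrow> F \<rho> = 0"
  shows "dr_inv f r z = F r"
proof -
  \<comment> \<open>Strictly beyond both \<open>r\<close> and \<open>R\<close>: from
    \<open>M\<close> on, every point is interior to the half-line and \<open>F\<close> is zero in a
    neighbourhood of it.\<close>
  define M where "M = max r R + 1"
  have M: "r < M" "R < M" by (auto simp: M_def)
  have f0: "f \<rho> z = 0" if "\<rho> \<ge> M" for \<rho>
  proof (rule DERIV_unique)
    have "at \<rho> within {r..} = at \<rho>"
      using that M by (intro at_within_interior) auto
    then show "(F has_real_derivative f \<rho> z) (at \<rho>)"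
      using F[of \<rho>] that M by simp
    show "(F has_real_derivative 0) (at \<rho>)"
      by (rule has_field_derivative_transform_within_open[of "\<lambda>_. 0" _ _ "{R<..}"])
         (use that M R in auto)
  qed
  have "((\<lambda>\<rho>. f \<rho> z) has_integral F M - F r) {r..M}"
  proof (rule fundamental_theorem_of_calculus)
    show "(F has_vector_derivative f \<rho> z) (at \<rho> within {r..M})" if "\<rho> \<in> {r..M}" for \<rho>
      unfolding has_real_derivative_iff_has_vector_derivative[symmetric]
      by (rule has_field_derivative_subset[OF F]) (use that in auto)
  qed (use M in simp)
  then have "((\<lambda>\<rho>. if \<rho> \<in> {r..M} then f \<rho> z else 0) has_integral F M - F r) {r..}"
    by (subst has_integral_restrict) auto
  then have "((\<lambda>\<rho>. f \<rho> z) has_integral F M - F r) {r..}"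
    by (rule has_integral_eq[rotated]) (use f0 in auto)
  then show ?thesis
    using R[OF M(2)] by (simp add: dr_inv_def integral_unique)
qed

section \<open>Calculus in the class of smooth compactly supported functions\<close>

abbreviation (input) half_plane :: "(real \<times> real) set" where
  "half_plane \<equiv> {0..} \<times> UNIV"

lemma axis_accessible_half_line: "axis_accessible {0::real..}"
proof (rule axis_accessible_real)
  fix x e :: real
  assume "x \<in> {0..}" "e > 0"
  then show "\<exists>y\<in>{0..}. y \<noteq> x \<and> \<bar>y - x\<bar> < e"
    by (intro bexI[of _ "x + e / 2"]) auto
qed

lemma axis_accessible_half_plane: "axis_accessible half_plane"
  by (intro axis_accessible_Times axis_accessible_half_line axis_accessible_UNIV)

text \<open>The box stays explicit because derivatives and \<open>dr_inv\<close> preserve it: one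
  \<open>R\<close> then serves a function, its derivatives and its radial antiderivative.\<close>

definition vanishes_outside :: "real \<Rightarrow> real \<Rightarrow> (real \<Rightarrow> real \<Rightarrow> real) \<Rightarrow> bool" where
  "vanishes_outside R Z w \<longleftrightarrow> (\<forall>r\<ge>0. \<forall>z. R < r \<or> Z < \<bar>z\<bar> \<longrightarrow> w r z = 0)"

lemma vanishes_outside_iff:
  "vanishes_outside R Z w \<longleftrightarrow> {(r, z). 0 \<le> r \<and> w r z \<noteq> 0} \<subseteq> {0..R} \<times> {-Z..Z}"
  unfolding vanishes_outside_def by (auto simp: abs_le_iff not_less[symmetric]) fastforce+

lemma Cc_smooth_iff:
  "w \<in> Cc_smooth \<longleftrightarrow>
     smooth_on half_plane (\<lambda>(r, z). w r z) \<and> (\<exists>R>0. \<exists>Z>0. vanishes_outside R Z w)"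
  by (simp add: Cc_smooth_def vanishes_outside_iff)

definition dir_deriv :: "real \<times> real \<Rightarrow> (real \<Rightarrow> real \<Rightarrow> real) \<Rightarrow> real \<Rightarrow> real \<Rightarrow> real" where
  "dir_deriv v w r z = frechet_derivative (\<lambda>(r, z). w r z) (at (r, z) within half_plane) v"

lemma Cc_smooth_has_derivative:
  assumes "w \<in> Cc_smooth" "0 \<le> r"
  shows "((\<lambda>(r, z). w r z) has_derivative (\<lambda>v. dir_deriv v w r z)) (at (r, z) within half_plane)"
  unfolding dir_deriv_def using assms
  by (intro smooth_on_has_derivative) (auto simp: Cc_smooth_iff)

text \<open>The exterior of the box is open, so \<open>w\<close> is zero near the point within the
  half-plane, and the derivative there is unique.\<close>

lemma vanishes_outside_derivative:
  assumes w: "vanishes_outside R Z w" and "0 \<le> r" "R < r \<or> Z < \<bar>z\<bar>"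
    and D: "((\<lambda>(r, z). w r z) has_derivative D) (at (r, z) within half_plane)"
  shows "D = (\<lambda>v. 0)"
proof -
  have "open {p::real \<times> real. R < fst p \<or> Z < \<bar>snd p\<bar>}"
    by (intro open_Collect_disj open_Collect_less continuous_intros)
  then obtain e where "e > 0" and e: "ball (r, z) e \<subseteq> {p. R < fst p \<or> Z < \<bar>snd p\<bar>}"
    using assms(3) openE[of _ "(r, z)"] by (metis (mono_tags, lifting) fst_conv mem_Collect_eq snd_conv)
  have "((\<lambda>(r, z). w r z) has_derivative (\<lambda>v. 0)) (at (r, z) within half_plane)"
  proof (rule has_derivative_transform_within[of "\<lambda>_. 0"])
    fix p assume p: "p \<in> half_plane" "dist p (r, z) < e"
    then have "p \<in> ball (r, z) e" by (simp add: dist_commute)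
    with e p w show "0 = (case p of (r, z) \<Rightarrow> w r z)"
      by (auto simp: vanishes_outside_def split: prod.split)
  qed (use assms \<open>e > 0\<close> in auto)
  with D show ?thesis
    using frechet_derivative_within_eq[OF axis_accessible_half_plane, of "(r, z)"] \<open>0 \<le> r\<close>
    by (metis (no_types, lifting) SigmaI UNIV_I atLeast_iff)
qed

lemma vanishes_outside_dir_deriv:
  assumes "w \<in> Cc_smooth" "vanishes_outside R Z w"
  shows "vanishes_outside R Z (dir_deriv v w)"
  unfolding vanishes_outside_def
proof (intro allI impI)
  fix r z :: real
  assume r: "0 \<le> r" "R < r \<or> Z < \<bar>z\<bar>"
  show "dir_deriv v w r z = 0"
    using vanishes_outside_derivative[OF assms(2) r Cc_smooth_has_derivative[OF assms(1) r(1)]]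
    by metis
qed

lemma dir_deriv_Cc_smooth:
  assumes "w \<in> Cc_smooth"
  shows "dir_deriv v w \<in> Cc_smooth"
proof -
  obtain R Z where "0 < R" "0 < Z" "vanishes_outside R Z w"
    and w: "smooth_on half_plane (\<lambda>(r, z). w r z)"
    using assms by (auto simp: Cc_smooth_iff)
  moreover have "smooth_on half_plane (\<lambda>(r, z). dir_deriv v w r z)"
    using smooth_on_frechet_derivative[OF w, of v] by (simp add: dir_deriv_def case_prod_beta')
  ultimately show ?thesis
    using vanishes_outside_dir_deriv[OF assms] unfolding Cc_smooth_iff by blast
qed

lemma Cc_smooth_cong:
  assumes "\<And>r z. 0 \<le> r \<Longrightarrow> w r z = w' r z"
  shows "w \<in> Cc_smooth \<longleftrightarrow> w' \<in> Cc_smooth"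
proof -
  have "smooth_on half_plane (\<lambda>(r, z). w r z) \<longleftrightarrow> smooth_on half_plane (\<lambda>(r, z). w' r z)"
    by (rule smooth_on_cong) (auto simp: assms)
  then show ?thesis by (simp add: Cc_smooth_iff vanishes_outside_def assms)
qed

text \<open>The vertical line through a point stays in the half-plane even at \<open>r = 0\<close>,
  so the \<open>z\<close>-derivative is two-sided, as \<open>deriv\<close> requires. The
  \<open>r\<close>-derivative is one-sided at the boundary.\<close>

lemma slice_derivatives:
  assumes D: "((\<lambda>(r, z). w r z) has_derivative D) (at (r, z) within half_plane)" and "0 \<le> r"
  shows "(w r has_real_derivative D (0, 1)) (at z)"
    and "((\<lambda>\<rho>. w \<rho> z) has_real_derivative D (1, 0)) (at r within {0..})"
    and "dz w r z = D (0, 1)"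
proof -
  interpret D: bounded_linear D using D by (rule has_derivative_bounded_linear)
  have "((\<lambda>y. (r, y)) has_derivative (\<lambda>h. (0, h))) (at z)"
    by (rule has_derivative_Pair[OF has_derivative_const has_derivative_ident])
  moreover have "((\<lambda>(r, z). w r z) has_derivative D) (at (r, z) within range (Pair r))"
    by (rule has_derivative_subset[OF D]) (use \<open>0 \<le> r\<close> in auto)
  ultimately have "((\<lambda>y. w r y) has_derivative (\<lambda>h. D (0, h))) (at z)"
    using has_derivative_in_compose[of "\<lambda>y. (r, y)" "\<lambda>h. (0, h)" z UNIV "\<lambda>(r, z). w r z" D]
    by simp
  moreover have "(\<lambda>h. D (0, h)) = (*) (D (0, 1))"
  proof
    show "D (0, h) = D (0, 1) * h" for h
      using D.scaleR[of h "(0, 1)"] by simp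
  qed
  ultimately show z: "(w r has_real_derivative D (0, 1)) (at z)"
    by (simp only: has_field_derivative_def)
  then show "dz w r z = D (0, 1)"
    unfolding dz_def by (rule DERIV_imp_deriv)
  have "((\<lambda>\<rho>. (\<rho>, z)) has_derivative (\<lambda>h. (h, 0))) (at r within {0..})"
    by (rule has_derivative_Pair[OF has_derivative_ident has_derivative_const])
  moreover have "((\<lambda>(r, z). w r z) has_derivative D) (at (r, z) within (\<lambda>\<rho>. (\<rho>, z)) ` {0..})"
    using D by (rule has_derivative_subset) auto
  ultimately have "((\<lambda>\<rho>. w \<rho> z) has_derivative (\<lambda>h. D (h, 0))) (at r within {0..})"
    using has_derivative_in_compose[of "\<lambda>\<rho>. (\<rho>, z)" "\<lambda>h. (h, 0)" r "{0..}" "\<lambda>(r, z). w r z" D]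
    by simp
  moreover have "(\<lambda>h. D (h, 0)) = (*) (D (1, 0))"
  proof
    show "D (h, 0) = D (1, 0) * h" for h
      using D.scaleR[of h "(1, 0)"] by simp
  qed
  ultimately show "((\<lambda>\<rho>. w \<rho> z) has_real_derivative D (1, 0)) (at r within {0..})"
    by (simp only: has_field_derivative_def)
qed

lemma
  assumes "w \<in> Cc_smooth" "0 \<le> r"
  shows Cc_smooth_has_dz: "(w r has_real_derivative dz w r z) (at z)"
    and Cc_smooth_has_dr: "((\<lambda>\<rho>. w \<rho> z) has_real_derivative dir_deriv (1, 0) w r z) (at r within {0..})"
    and dz_eq_dir_deriv: "dz w r z = dir_deriv (0, 1) w r z"
  using slice_derivatives[OF Cc_smooth_has_derivative[OF assms] assms(2)] by auto

lemma dz_Cc_smooth: "w \<in> Cc_smooth \<Longrightarrow> dz w \<in> Cc_smooth"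
  using dir_deriv_Cc_smooth[of w "(0, 1)"] dz_eq_dir_deriv[of w]
    Cc_smooth_cong[of "dz w" "dir_deriv (0, 1) w"] by auto

text \<open>Seen as an integral over translates of one fixed ray, \<open>dr_inv\<close> commutes
  with differentiation by the Leibniz rule.\<close>

lemma dr_inv_has_derivative:
  assumes w: "w \<in> Cc_smooth" and "0 \<le> r"
  shows "((\<lambda>(r, z). dr_inv w r z) has_derivative (\<lambda>v. dr_inv (dir_deriv v w) r z))
    (at (r, z) within half_plane)"
proof -
  obtain R Z where R: "0 < R" "vanishes_outside R Z w"
    using w by (auto simp: Cc_smooth_iff)
  have "((\<lambda>p. - integral {0..R} (\<lambda>s. (\<lambda>(r, z). w r z) (p + s *\<^sub>R (1, 0)))) has_derivative
      (\<lambda>v. - integral {0..R} (\<lambda>s. (\<lambda>(r, z). dir_deriv v w r z) ((r, z) + s *\<^sub>R (1, 0)))))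
      (at (r, z) within half_plane)"
  proof (rule has_derivative_minus, rule has_derivative_ray_integral)
    show "((\<lambda>(r, z). w r z) has_derivative (\<lambda>v. (\<lambda>(r, z). dir_deriv v w r z) p)) (at p within half_plane)"
      if "p \<in> half_plane" for p
      using Cc_smooth_has_derivative[OF w] that by (cases p) auto
    show "continuous_on half_plane (\<lambda>p. (\<lambda>(r, z). dir_deriv v w r z) p)" for v
      using dir_deriv_Cc_smooth[OF w, of v] by (simp add: Cc_smooth_iff smooth_on_continuous)
  qed (use \<open>0 \<le> r\<close> in \<open>auto intro!: convex_Times\<close>)
  \<comment> \<open>Applied both to \<open>w\<close> and to \<open>dir_deriv v w\<close>, which
    share the box and hence \<open>R\<close>.\<close>
  moreover have eq: "dr_inv u r z = - integral {0..R} (\<lambda>s. (\<lambda>(r, z). u r z) ((r, z) + s *\<^sub>R (1, 0)))"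
    if "vanishes_outside R Z u" "0 \<le> r" for u r z
    using that R by (subst dr_inv_eq_integral[of r R]) (auto simp: vanishes_outside_def)
  ultimately have "((\<lambda>p. - integral {0..R} (\<lambda>s. (\<lambda>(r, z). w r z) (p + s *\<^sub>R (1, 0)))) has_derivative
      (\<lambda>v. dr_inv (dir_deriv v w) r z)) (at (r, z) within half_plane)"
    using \<open>0 \<le> r\<close> vanishes_outside_dir_deriv[OF w R(2)] by simp
  then show ?thesis
    by (rule has_derivative_transform[rotated -1]) (use \<open>0 \<le> r\<close> R(2) eq in auto)
qed

text \<open>A ray towards larger radii that starts outside the box never enters it.\<close>

lemma vanishes_outside_dr_inv:
  assumes "vanishes_outside R Z w"
  shows "vanishes_outside R Z (dr_inv w)"
  unfolding vanishes_outside_def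
proof (intro allI impI)
  fix r z :: real
  assume "0 \<le> r" "R < r \<or> Z < \<bar>z\<bar>"
  then have "w \<rho> z = 0" if "\<rho> \<ge> r" for \<rho>
    using that assms by (auto simp: vanishes_outside_def)
  then have "dr_inv w r z = dr_inv (\<lambda>r z. 0) r z"
    by (rule dr_inv_cong)
  then show "dr_inv w r z = 0" by (simp add: dr_inv_def)
qed

text \<open>The images under \<open>dr_inv\<close> form a class closed under differentiation,
  because \<open>dir_deriv v w\<close> is again in \<open>Cc_smooth\<close>.\<close>

lemma dr_inv_Cc_smooth:
  assumes "w \<in> Cc_smooth"
  shows "dr_inv w \<in> Cc_smooth"
proof -
  have "smooth_on half_plane (\<lambda>(r, z). dr_inv w r z)"
  proof (rule smooth_on_coinduct[OF axis_accessible_half_plane,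
        where X = "\<lambda>f. \<exists>w\<in>Cc_smooth. f = (\<lambda>(r, z). dr_inv w r z)"])
    fix f :: "real \<times> real \<Rightarrow> real"
    assume "\<exists>w\<in>Cc_smooth. f = (\<lambda>(r, z). dr_inv w r z)"
    then obtain w where w: "w \<in> Cc_smooth" and f: "f = (\<lambda>(r, z). dr_inv w r z)" by blast
    show "\<exists>D. (\<forall>x\<in>half_plane. (f has_derivative D x) (at x within half_plane)) \<and>
        (\<forall>v. \<exists>g. (\<exists>w\<in>Cc_smooth. g = (\<lambda>(r, z). dr_inv w r z)) \<and> (\<forall>x\<in>half_plane. D x v = g x))"
    proof (intro exI[of _ "\<lambda>x v. (\<lambda>(r, z). dr_inv (dir_deriv v w) r z) x"] conjI ballI allI)
      show "(f has_derivative (\<lambda>v. (\<lambda>(r, z). dr_inv (dir_deriv v w) r z) x)) (at x within half_plane)"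
        if "x \<in> half_plane" for x
        using that dr_inv_has_derivative[OF w] by (cases x) (auto simp: f)
      show "\<exists>g. (\<exists>w\<in>Cc_smooth. g = (\<lambda>(r, z). dr_inv w r z)) \<and>
          (\<forall>x\<in>half_plane. (\<lambda>(r, z). dr_inv (dir_deriv v w) r z) x = g x)" for v
        using dir_deriv_Cc_smooth[OF w] by blast
    qed
  qed (use assms in blast)
  moreover obtain R Z where RZ: "0 < R" "0 < Z" "vanishes_outside R Z w"
    using assms by (auto simp: Cc_smooth_iff)
  have "vanishes_outside R Z (dr_inv w)"
    by (rule vanishes_outside_dr_inv[OF RZ(3)])
  ultimately show ?thesis using RZ by (auto simp: Cc_smooth_iff)
qed

lemma dr_inv_dr:
  assumes w: "w \<in> Cc_smooth" and "0 \<le> r"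
  shows "dr_inv (dir_deriv (1, 0) w) r z = w r z"
proof -
  obtain R Z where R: "0 < R" "vanishes_outside R Z w"
    using w by (auto simp: Cc_smooth_iff)
  show ?thesis
  proof (rule dr_inv_eqI)
    show "((\<lambda>\<rho>. w \<rho> z) has_real_derivative dir_deriv (1, 0) w \<rho> z) (at \<rho> within {r..})" if "r \<le> \<rho>" for \<rho>
      by (rule has_field_derivative_subset[OF Cc_smooth_has_dr[OF w]]) (use that \<open>0 \<le> r\<close> in auto)
    show "w \<rho> z = 0" if "\<rho> > R" for \<rho>
      using R that by (auto simp: vanishes_outside_def)
  qed
qed

text \<open>The Leibniz rule gives \<open>dr_inv\<close> of the radial derivative, which the
  fundamental theorem evaluates to \<open>w\<close> by compact support.\<close>

lemma dr_inv_has_dr: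
  assumes "w \<in> Cc_smooth" "0 \<le> r"
  shows "((\<lambda>\<rho>. dr_inv w \<rho> z) has_real_derivative w r z) (at r within {0..})"
  using slice_derivatives(2)[OF dr_inv_has_derivative[OF assms] assms(2)] dr_inv_dr[OF assms]
  by simp

lemma dz_dr_inv:
  assumes "w \<in> Cc_smooth" "0 \<le> r"
  shows "dz (dr_inv w) r z = dr_inv (dz w) r z"
proof -
  have "dr_inv (dz w) r z = dr_inv (dir_deriv (0, 1) w) r z"
    using assms by (intro dr_inv_cong dz_eq_dir_deriv) auto
  then show ?thesis
    using slice_derivatives(3)[OF dr_inv_has_derivative[OF assms] assms(2)] by simp
qed

section \<open>Strong solutions along characteristics\<close>

abbreviation (input) space_time :: "ereal \<Rightarrow> (real \<times> real \<times> real) set" where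
  "space_time T \<equiv> {0..} \<times> UNIV \<times> times_below T"

lemma times_below_downward: "S \<in> times_below T \<Longrightarrow> 0 \<le> t \<Longrightarrow> t \<le> S \<Longrightarrow> t \<in> times_below T"
  unfolding times_below_def using le_less_trans[of "ereal t" "ereal S" T] by auto

lemma zero_in_times_below: "0 < T \<Longrightarrow> 0 \<in> times_below T"
  by (simp add: times_below_def zero_ereal_def[symmetric])

lemma axis_accessible_times_below: "axis_accessible (times_below T)"
proof (rule axis_accessible_real)
  fix t e :: real
  assume t: "t \<in> times_below T" and "e > 0"
  \<comment> \<open>The minimum keeps \<open>s\<close> below \<open>T\<close>, finite or infinite,
    and within \<open>e\<close> of \<open>t\<close>.\<close>
  then have "ereal t < min T (ereal (t + e))" by (simp add: times_below_def)
  then obtain s where "ereal t < ereal s" "ereal s < min T (ereal (t + e))"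
    using ereal_dense2 by blast
  with t show "\<exists>s\<in>times_below T. s \<noteq> t \<and> \<bar>s - t\<bar> < e"
    by (intro bexI[of _ s]) (auto simp: times_below_def)
qed

text \<open>\<open>vector_derivative\<close> is a choice and is determined only at limit points.
  This makes the time derivative in \<open>strong_solution\<close> computable, also at
  \<open>t = 0\<close>.\<close>

lemma at_within_times_below_nontrivial:
  assumes "t \<in> times_below T"
  shows "at t within times_below T \<noteq> bot"
proof -
  have "t islimpt times_below T"
    unfolding islimpt_approachable_real
  proof (intro allI impI)
    fix e :: real
    assume "e > 0"
    moreover have "(1 :: real) \<in> Basis" by simp
    ultimately obtain d where "0 < \<bar>d\<bar>" "\<bar>d\<bar> < e" "t + d *\<^sub>R 1 \<in> times_below T"
      using axis_accessible_times_below[of T] assms unfolding axis_accessible_def by blast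
    then show "\<exists>s\<in>times_below T. s \<noteq> t \<and> \<bar>s - t\<bar> < e"
      by (intro bexI[of _ "t + d"]) auto
  qed
  then show ?thesis by (simp add: trivial_limit_within)
qed

lemma axis_accessible_space_time: "axis_accessible (space_time T)"
  by (intro axis_accessible_Times axis_accessible_half_line axis_accessible_UNIV
      axis_accessible_times_below)

text \<open>With the integrating factor \<open>exp (- A t)\<close> the product has derivative zero,
  so it keeps its initial value 0.\<close>

lemma linear_ode_zero:
  fixes \<psi> a :: "real \<Rightarrow> real"
  assumes deriv: "\<And>t. t \<in> {0..S} \<Longrightarrow> (\<psi> has_real_derivative a t * \<psi> t) (at t within {0..S})"
    and cont: "continuous_on {0..S} a" and "\<psi> 0 = 0" "t \<in> {0..S}"
  shows "\<psi> t = 0"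
proof -
  define A where "A t = integral {0..t} a" for t
  have A: "(A has_real_derivative a t) (at t within {0..S})" if "t \<in> {0..S}" for t
    unfolding A_def by (rule integral_has_real_derivative[OF cont that])
  have "((\<lambda>t. \<psi> t * exp (- A t)) has_real_derivative 0) (at t within {0..S})" if "t \<in> {0..S}" for t
    using deriv[OF that] A[OF that] by (auto intro!: derivative_eq_intros)
  then obtain c where c: "\<And>t. t \<in> {0..S} \<Longrightarrow> \<psi> t * exp (- A t) = c"
    using has_field_derivative_zero_constant[of "{0..S}" "\<lambda>t. \<psi> t * exp (- A t)"] by auto
  have "c = 0" using c[of 0] assms(3,4) by simp
  with c[OF \<open>t \<in> {0..S}\<close>] show ?thesis by simp
qed

lemma slice_derivatives3:
  fixes f :: "real \<Rightarrow> real \<Rightarrow> real \<Rightarrow> real"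
  assumes D: "((\<lambda>(r, z, t). f r z t) has_derivative D) (at (r, z, t) within A \<times> B \<times> C)"
    and "r \<in> A" "z \<in> B" "t \<in> C"
  shows "((\<lambda>r. f r z t) has_real_derivative D (1, 0, 0)) (at r within A)"
    and "((\<lambda>z. f r z t) has_real_derivative D (0, 1, 0)) (at z within B)"
    and "((\<lambda>t. f r z t) has_real_derivative D (0, 0, 1)) (at t within C)"
proof -
  interpret D: bounded_linear D using D by (rule has_derivative_bounded_linear)
  have slice: "((\<lambda>s. (\<lambda>(r, z, t). f r z t) (c s)) has_real_derivative D v) (at s within X)"
    if "(c has_derivative (\<lambda>x. x *\<^sub>R v)) (at s within X)" "c s = (r, z, t)" "c ` X \<subseteq> A \<times> B \<times> C"
    for c v X and s :: real
  proof -
    have "((\<lambda>(r, z, t). f r z t) has_derivative D) (at (c s) within c ` X)"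
      unfolding that(2) using D that(3) by (rule has_derivative_subset)
    from has_derivative_in_compose[OF that(1) this]
    show ?thesis
      by (simp add: has_field_derivative_def D.scaleR mult.commute[of _ "D v"])
  qed
  show "((\<lambda>r. f r z t) has_real_derivative D (1, 0, 0)) (at r within A)"
  proof -
    have "((\<lambda>r. (r, z, t)) has_derivative (\<lambda>x. x *\<^sub>R (1, 0, 0))) (at r within A)"
      by (auto intro!: derivative_eq_intros simp: zero_prod_def)
    from slice[OF this] assms(2-) show ?thesis by auto
  qed
  show "((\<lambda>z. f r z t) has_real_derivative D (0, 1, 0)) (at z within B)"
  proof -
    have "((\<lambda>z. (r, z, t)) has_derivative (\<lambda>x. x *\<^sub>R (0, 1, 0))) (at z within B)"
      by (auto intro!: derivative_eq_intros)
    from slice[OF this] assms(2-) show ?thesis by auto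
  qed
  show "((\<lambda>t. f r z t) has_real_derivative D (0, 0, 1)) (at t within C)"
  proof -
    have "((\<lambda>t. (r, z, t)) has_derivative (\<lambda>x. x *\<^sub>R (0, 0, 1))) (at t within C)"
      by (auto intro!: derivative_eq_intros)
    from slice[OF this] assms(2-) show ?thesis by auto
  qed
qed

lemma smooth_on_slice:
  fixes w :: "real \<Rightarrow> real \<Rightarrow> real \<Rightarrow> real"
  assumes "smooth_on (space_time T) (\<lambda>(r, z, t). w r z t)" "t \<in> times_below T"
  shows "smooth_on half_plane (\<lambda>(r, z). w r z t)"
proof -
  have "smooth_on half_plane (\<lambda>p. (\<lambda>(r, z, t). w r z t) ((fst p, snd p, 0) + (0, 0, t)))"
    using assms
    by (intro smooth_on_compose_affine[where B = "space_time T" and L = "\<lambda>p. (fst p, snd p, 0)"]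
        axis_accessible_half_plane axis_accessible_space_time bounded_linear_Pair
        bounded_linear_fst bounded_linear_snd bounded_linear_zero) auto
  then show ?thesis by (simp add: case_prod_beta')
qed

text \<open>The solution and its horizon \<open>T\<close> are arbitrary, so that uniqueness and the
  upper bound on the lifespan both rest on the same facts.\<close>

locale vorticity_solution =
  fixes w0 :: "real \<Rightarrow> real \<Rightarrow> real" and T :: ereal and w :: "real \<Rightarrow> real \<Rightarrow> real \<Rightarrow> real"
  assumes w0: "w0 \<in> Cc_smooth" and sol: "strong_solution w0 T w"
begin

lemma smooth: "smooth_on (space_time T) (\<lambda>(r, z, t). w r z t)"
  using sol by (simp add: strong_solution_def smooth_curve_Cc_def)

lemma T_pos: "0 < T"
  using sol by (simp add: strong_solution_def)

lemma initial: "0 \<le> r \<Longrightarrow> w r z 0 = w0 r z"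
  using sol by (simp add: strong_solution_def)

lemma uniform_support:
  assumes "S \<in> times_below T"
  obtains R Z where "R > 0" "Z > 0" "\<And>t. t \<in> {0..S} \<Longrightarrow> vanishes_outside R Z (\<lambda>r z. w r z t)"
proof -
  have "\<exists>R>0. \<exists>Z>0. \<forall>t\<in>{0..S}. vanishes_outside R Z (\<lambda>r z. w r z t)"
    using sol assms by (simp add: strong_solution_def smooth_curve_Cc_def vanishes_outside_iff)
  with that show thesis by blast
qed

lemma slice_Cc_smooth:
  assumes "t \<in> times_below T"
  shows "(\<lambda>r z. w r z t) \<in> Cc_smooth"
proof -
  obtain R Z where "R > 0" "Z > 0" "\<And>s. s \<in> {0..t} \<Longrightarrow> vanishes_outside R Z (\<lambda>r z. w r z s)"
    using uniform_support[OF assms] by blast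
  moreover have "t \<in> {0..t}" using assms by (simp add: times_below_def)
  ultimately show ?thesis
    using smooth_on_slice[OF smooth assms] unfolding Cc_smooth_iff by blast
qed

definition \<Phi> :: "real \<Rightarrow> real \<Rightarrow> real \<Rightarrow> real" where
  "\<Phi> r z t = dr_inv (\<lambda>r z. w r z t) r z"

definition dw :: "real \<times> real \<times> real \<Rightarrow> real \<times> real \<times> real \<Rightarrow> real" where
  "dw p = frechet_derivative (\<lambda>(r, z, t). w r z t) (at p within space_time T)"

lemma w_has_derivative:
  "p \<in> space_time T \<Longrightarrow> ((\<lambda>(r, z, t). w r z t) has_derivative dw p) (at p within space_time T)"
  unfolding dw_def by (rule smooth_on_has_derivative[OF smooth])

lemma smooth_dw: "smooth_on (space_time T) (\<lambda>p. dw p v)"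
  unfolding dw_def by (rule smooth_on_frechet_derivative[OF smooth])

lemma dw_z:
  assumes "0 \<le> r" "t \<in> times_below T"
  shows "dw (r, z, t) (0, 1, 0) = dz (\<lambda>r z. w r z t) r z"
  using slice_derivatives3(2)[OF w_has_derivative[of "(r, z, t)"]] assms
  by (simp add: dz_def DERIV_imp_deriv)

text \<open>Here the equation enters, as a formula for one component of the full space-time
  derivative.\<close>

lemma dw_t:
  assumes "0 \<le> r" "t \<in> times_below T"
  shows "dw (r, z, t) (0, 0, 1) =
    - (\<Phi> r z t * dz (\<lambda>r z. w r z t) r z + w r z t * dz (\<lambda>r z. \<Phi> r z t) r z)"
proof -
  have "((\<lambda>s. w r z s) has_real_derivative dw (r, z, t) (0, 0, 1)) (at t within times_below T)"
    using slice_derivatives3(3)[OF w_has_derivative[of "(r, z, t)"]] assms by simp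
  with at_within_times_below_nontrivial[OF assms(2)]
  have "vector_derivative (\<lambda>s. w r z s) (at t within times_below T) = dw (r, z, t) (0, 0, 1)"
    by (intro vector_derivative_within) (simp_all add: has_real_derivative_iff_has_vector_derivative)
  moreover have "vector_derivative (\<lambda>s. w r z s) (at t within times_below T)
     + \<Phi> r z t * dz (\<lambda>r z. w r z t) r z + w r z t * dz (\<lambda>r z. \<Phi> r z t) r z = 0"
    using sol assms by (simp add: strong_solution_def Let_def \<Phi>_def)
  ultimately show ?thesis by simp
qed

lemma \<Phi>_Cc_smooth: "t \<in> times_below T \<Longrightarrow> (\<lambda>r z. \<Phi> r z t) \<in> Cc_smooth"
  unfolding \<Phi>_def by (rule dr_inv_Cc_smooth[OF slice_Cc_smooth])

text \<open>
  The radial derivative of \<open>\<partial>\<^sub>t\<Phi> + \<Phi> \<partial>\<^sub>z\<Phi>\<close> is the left-hand side of the vorticity equation, so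
  \<open>\<Phi>\<close> solves the inviscid Burgers equation in \<open>z\<close> for each \<open>r\<close>.
\<close>

lemma integral_dw:
  assumes "0 \<le> r" and t: "t \<in> times_below T"
    and "R > 0" and R: "vanishes_outside R Z (\<lambda>r z. w r z t)"
  shows "- integral {0..R} (\<lambda>s. dw (r + s, z, t) (0, a, 1)) = (a - \<Phi> r z t) * dz (\<lambda>r z. \<Phi> r z t) r z"
proof -
  define u where "u = (\<lambda>r z. w r z t)"
  define \<phi> where "\<phi> = (\<lambda>r z. \<Phi> r z t)"
  \<comment> \<open>The derivative of the vorticity in direction \<open>(0, a, 1)\<close>, with the
    time derivative replaced by means of the equation.\<close>
  define g where "g r z = a * dz u r z - (\<phi> r z * dz u r z + u r z * dz \<phi> r z)" for r z
  have u: "u \<in> Cc_smooth" unfolding u_def by (rule slice_Cc_smooth[OF t])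
  have \<phi>: "\<phi> = dr_inv u" by (auto simp: \<phi>_def u_def \<Phi>_def)
  have dz\<phi>: "dz \<phi> \<rho> z = dr_inv (dz u) \<rho> z" if "0 \<le> \<rho>" for \<rho>
    unfolding \<phi> by (rule dz_dr_inv[OF u that])
  have dw: "dw (\<rho>, z, t) (0, a, 1) = g \<rho> z" if "0 \<le> \<rho>" for \<rho>
  proof -
    interpret dw: bounded_linear "dw (\<rho>, z, t)"
      using w_has_derivative[of "(\<rho>, z, t)"] that t by (auto dest: has_derivative_bounded_linear)
    have "dw (\<rho>, z, t) (0, a, 1) = dw (\<rho>, z, t) (a *\<^sub>R (0, 1, 0) + (0, 0, 1))" by simp
    also have "\<dots> = a * dw (\<rho>, z, t) (0, 1, 0) + dw (\<rho>, z, t) (0, 0, 1)"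
      by (simp only: dw.add dw.scaleR real_scaleR_def)
    finally show ?thesis
      using dw_z[OF that t] dw_t[OF that t] by (simp add: g_def u_def \<phi>_def)
  qed
  have u0: "u \<rho> z = 0 \<and> dz u \<rho> z = 0" if "\<rho> > R" "0 \<le> \<rho>" for \<rho>
    using R vanishes_outside_dir_deriv[OF u, of R Z "(0, 1)"] dz_eq_dir_deriv[OF u] that
    by (auto simp: vanishes_outside_def u_def)
  have "- integral {0..R} (\<lambda>s. dw (r + s, z, t) (0, a, 1)) = - integral {0..R} (\<lambda>s. g (r + s) z)"
    using dw \<open>0 \<le> r\<close> by (auto intro!: integral_cong)
  also have "\<dots> = dr_inv g r z"
    by (rule dr_inv_eq_integral[symmetric]) (use u0 \<open>0 \<le> r\<close> \<open>R > 0\<close> in \<open>simp add: g_def\<close>)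
  also have "\<dots> = (a - \<phi> r z) * dr_inv (dz u) r z"
  \<comment> \<open>The product is a radial antiderivative of \<open>g\<close>: the radial
    derivative of \<open>\<phi>\<close> is \<open>u\<close>, and that of
    \<open>dr_inv (dz u)\<close>, which equals \<open>dz \<phi>\<close>, is
    \<open>dz u\<close>.\<close>
  proof (rule dr_inv_eqI[where F = "\<lambda>r. (a - \<phi> r z) * dr_inv (dz u) r z"])
    show "((\<lambda>r. (a - \<phi> r z) * dr_inv (dz u) r z) has_real_derivative g \<rho> z) (at \<rho> within {r..})"
      if "r \<le> \<rho>" for \<rho>
    proof -
      have "((\<lambda>r. \<phi> r z) has_real_derivative u \<rho> z) (at \<rho> within {r..})"
        unfolding \<phi> by (rule has_field_derivative_subset[OF dr_inv_has_dr[OF u]])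
          (use that \<open>0 \<le> r\<close> in auto)
      moreover have "((\<lambda>r. dr_inv (dz u) r z) has_real_derivative dz u \<rho> z) (at \<rho> within {r..})"
        by (rule has_field_derivative_subset[OF dr_inv_has_dr[OF dz_Cc_smooth[OF u]]])
          (use that \<open>0 \<le> r\<close> in auto)
      ultimately show ?thesis
        using dz\<phi>[of \<rho>] that \<open>0 \<le> r\<close>
        by (auto intro!: derivative_eq_intros simp: g_def algebra_simps)
    qed
    show "(a - \<phi> \<rho> z) * dr_inv (dz u) \<rho> z = 0" if "\<rho> > max R 0" for \<rho>
    proof -
      have "dr_inv (dz u) \<rho> z = dr_inv (\<lambda>r z. 0) \<rho> z"
        by (rule dr_inv_cong) (use u0 that in auto)
      then show ?thesis by (simp add: dr_inv_def)
    qed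
  qed
  finally show ?thesis
    using dz\<phi>[OF \<open>0 \<le> r\<close>] by (simp add: \<phi>_def)
qed

text \<open>Moving in direction \<open>(0, a, 1)\<close> differentiates under the radial integral,
  which \<open>integral_dw\<close> evaluates. The slope \<open>a\<close> is still arbitrary. Times
  are restricted to \<open>{0..S}\<close>, where one support box is valid throughout.\<close>

lemma \<Phi>_along_line:
  assumes S: "S \<in> times_below T" and t: "t \<in> {0..S}" and "0 \<le> r"
  shows "((\<lambda>t. \<Phi> r (y + t * a) t) has_real_derivative
      (a - \<Phi> r (y + t * a) t) * dz (\<lambda>r z. \<Phi> r z t) r (y + t * a)) (at t within {0..S})"
proof -
  define U :: "(real \<times> real \<times> real) set" where "U = {0..} \<times> UNIV \<times> {0..S}"
  have US: "U \<subseteq> space_time T"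
    using times_below_downward[OF S] by (auto simp: U_def)
  obtain R Z where R: "R > 0" "\<And>t. t \<in> {0..S} \<Longrightarrow> vanishes_outside R Z (\<lambda>r z. w r z t)"
    using uniform_support[OF S] by blast
  define D where "D v = - integral {0..R} (\<lambda>s. dw ((r, y + t * a, t) + s *\<^sub>R (1, 0, 0)) v)" for v
  define I where "I p = - integral {0..R} (\<lambda>s. (\<lambda>(r, z, t). w r z t) (p + s *\<^sub>R (1, 0, 0)))" for p
  have p: "(r, y + t * a, t) \<in> U" using t \<open>0 \<le> r\<close> by (simp add: U_def)
  have D: "(I has_derivative D) (at (r, y + t * a, t) within U)"
    unfolding I_def D_def
  proof (rule has_derivative_minus, rule has_derivative_ray_integral)
    show "((\<lambda>(r, z, t). w r z t) has_derivative dw p) (at p within U)" if "p \<in> U" for p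
      using that US by (intro has_derivative_subset[OF w_has_derivative]) auto
    show "continuous_on U (\<lambda>p. dw p v)" for v
      using smooth_on_continuous[OF smooth_dw] US by (rule continuous_on_subset)
    show "convex U" unfolding U_def by (intro convex_Times) auto
  qed (use p in \<open>auto simp: U_def\<close>)
  interpret D: bounded_linear D using D by (rule has_derivative_bounded_linear)
  have I: "I (r, z, t) = \<Phi> r z t" if "t \<in> {0..S}" for z t
    unfolding I_def \<Phi>_def using R(1) R(2)[OF that] \<open>0 \<le> r\<close>
    by (subst dr_inv_eq_integral[where R = R]) (auto simp: vanishes_outside_def)
  have "((\<lambda>t. (r, y + t * a, t)) has_derivative (\<lambda>h. h *\<^sub>R (0, a, 1))) (at t within {0..S})"
    by (auto intro!: derivative_eq_intros)
  moreover have "(I has_derivative D) (at (r, y + t * a, t) within (\<lambda>t. (r, y + t * a, t)) ` {0..S})"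
    by (rule has_derivative_subset[OF D]) (use \<open>0 \<le> r\<close> in \<open>auto simp: U_def\<close>)
  ultimately have "((\<lambda>t. I (r, y + t * a, t)) has_derivative (\<lambda>h. D (h *\<^sub>R (0, a, 1)))) (at t within {0..S})"
    by (rule has_derivative_in_compose)
  then have "((\<lambda>t. \<Phi> r (y + t * a) t) has_derivative (\<lambda>h. D (h *\<^sub>R (0, a, 1)))) (at t within {0..S})"
    by (rule has_derivative_transform[rotated -1]) (use t I in auto)
  moreover have "(\<lambda>h. D (h *\<^sub>R (0, a, 1))) = (*) (D (0, a, 1))"
  proof
    show "D (h *\<^sub>R (0, a, 1)) = D (0, a, 1) * h" for h
      by (simp only: D.scaleR real_scaleR_def mult.commute)
  qed
  moreover have "D (0, a, 1) = (a - \<Phi> r (y + t * a) t) * dz (\<lambda>r z. \<Phi> r z t) r (y + t * a)"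
    unfolding D_def
    using integral_dw[OF \<open>0 \<le> r\<close> times_below_downward[OF S, of t] R(1) R(2)[OF t], of "y + t * a" a] t
    by simp
  ultimately show ?thesis by (simp only: has_field_derivative_def)
qed

text \<open>This is the coefficient of the linear equation on a line. Up to sign it is the ray
  integral of the \<open>z\<close>-derivative of the vorticity, which is differentiable by the
  Leibniz rule, hence continuous.\<close>

lemma continuous_dz_\<Phi>:
  assumes S: "S \<in> times_below T" and "0 \<le> r"
  shows "continuous_on {0..S} (\<lambda>t. dz (\<lambda>r z. \<Phi> r z t) r (y + t * a))"
proof -
  define U :: "(real \<times> real \<times> real) set" where "U = {0..} \<times> UNIV \<times> {0..S}"
  have US: "U \<subseteq> space_time T"
    using times_below_downward[OF S] by (auto simp: U_def)
  obtain R Z where R: "R > 0" "\<And>t. t \<in> {0..S} \<Longrightarrow> vanishes_outside R Z (\<lambda>r z. w r z t)"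
    using uniform_support[OF S] by blast
  define f where "f p = dw p (0, 1, 0)" for p
  define f' where "f' p = frechet_derivative f (at p within space_time T)" for p
  have f: "smooth_on (space_time T) f" unfolding f_def by (rule smooth_dw)
  define I where "I p = integral {0..R} (\<lambda>s. f (p + s *\<^sub>R (1, 0, 0)))" for p
  have "(I has_derivative (\<lambda>v. integral {0..R} (\<lambda>s. f' (p + s *\<^sub>R (1, 0, 0)) v))) (at p within U)"
    if "p \<in> U" for p
    unfolding I_def
  proof (rule has_derivative_ray_integral[OF _ _ _ _ that])
    show "(f has_derivative f' p) (at p within U)" if "p \<in> U" for p
      unfolding f'_def using that US
      by (intro has_derivative_subset[OF smooth_on_has_derivative[OF f]]) auto
    show "continuous_on U (\<lambda>p. f' p v)" for v
      unfolding f'_def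
      using smooth_on_continuous[OF smooth_on_frechet_derivative[OF f]] US
      by (rule continuous_on_subset)
    show "convex U" unfolding U_def by (intro convex_Times) auto
  qed (auto simp: U_def)
  then have I: "continuous_on U I" by (rule has_derivative_continuous_on)
  have "continuous_on {0..S} (\<lambda>t. (r, y + t * a, t))"
    by (intro continuous_intros)
  from continuous_on_compose2[OF I this]
  have "continuous_on {0..S} (\<lambda>t. - I (r, y + t * a, t))"
    using \<open>0 \<le> r\<close> by (intro continuous_on_minus) (simp add: U_def image_subset_iff)
  then show ?thesis
  proof (rule continuous_on_eq)
    fix t assume t: "t \<in> {0..S}"
    then have tT: "t \<in> times_below T" using times_below_downward[OF S] by auto
    define u where "u = (\<lambda>r z. w r z t)"
    have u: "u \<in> Cc_smooth" unfolding u_def by (rule slice_Cc_smooth[OF tT])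
    define z where "z = y + t * a"
    have "dz (\<lambda>r z. \<Phi> r z t) r z = dr_inv (dz u) r z"
      using dz_dr_inv[OF u \<open>0 \<le> r\<close>, of z] by (simp add: u_def \<Phi>_def)
    also have "dr_inv (dz u) r z = - integral {0..R} (\<lambda>s. dz u (r + s) z)"
    proof (rule dr_inv_eq_integral)
      show "dz u \<rho> z = 0" if "\<rho> > r + R" for \<rho>
        using vanishes_outside_dir_deriv[OF u, of R Z "(0, 1)"] R(2)[OF t] dz_eq_dir_deriv[OF u]
          that \<open>0 \<le> r\<close> \<open>R > 0\<close> by (simp add: vanishes_outside_def u_def)
    qed
    also have "integral {0..R} (\<lambda>s. dz u (r + s) z) = I (r, z, t)"
      unfolding I_def f_def u_def using \<open>0 \<le> r\<close> dw_z[OF _ tT] by (auto intro!: integral_cong)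
    finally show "- I (r, y + t * a, t) = dz (\<lambda>r z. \<Phi> r z t) r (y + t * a)"
      by (simp add: z_def)
  qed
qed

lemma \<Phi>_constant_along_characteristics:
  assumes t: "t \<in> times_below T" and "0 \<le> r"
  shows "\<Phi> r (flow_map (dr_inv w0) r t y) t = dr_inv w0 r y"
proof -
  \<comment> \<open>The slope is the initial value itself: for this choice the factor
    \<open>a - \<Phi>\<close> is minus the unknown, and the unknown starts at 0.\<close>
  define a where "a = dr_inv w0 r y"
  have "\<Phi> r (y + t * a) t - a = 0"
  proof (rule linear_ode_zero[where \<psi> = "\<lambda>t. \<Phi> r (y + t * a) t - a" and S = t])
    show "((\<lambda>t. \<Phi> r (y + t * a) t - a) has_real_derivative
        - dz (\<lambda>r z. \<Phi> r z s) r (y + s * a) * (\<Phi> r (y + s * a) s - a)) (at s within {0..t})"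
      if "s \<in> {0..t}" for s
      using DERIV_diff[OF \<Phi>_along_line[OF t that \<open>0 \<le> r\<close>, of y a] DERIV_const[of a]]
      by (simp add: algebra_simps)
    show "continuous_on {0..t} (\<lambda>s. - dz (\<lambda>r z. \<Phi> r z s) r (y + s * a))"
      by (intro continuous_on_minus continuous_dz_\<Phi> t \<open>0 \<le> r\<close>)
    have "\<Phi> r y 0 = dr_inv w0 r y"
      unfolding \<Phi>_def by (rule dr_inv_cong) (use initial \<open>0 \<le> r\<close> in auto)
    then show "\<Phi> r (y + 0 * a) 0 - a = 0" by (simp add: a_def)
    show "t \<in> {0..t}" using t by (simp add: times_below_def)
  qed
  then show ?thesis by (simp add: flow_map_def a_def mult.commute)
qed

lemma jacobian_nonzero:
  assumes t: "t \<in> times_below T" and "0 \<le> r"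
  shows "1 + t * dz (dr_inv w0) r y \<noteq> 0"
proof
  define \<phi>' where "\<phi>' = dz (dr_inv w0) r y"
  assume J: "1 + t * dz (dr_inv w0) r y = 0"
  let ?g = "flow_map (dr_inv w0) r t"
  have \<phi>': "(dr_inv w0 r has_real_derivative \<phi>') (at y)"
    unfolding \<phi>'_def by (rule Cc_smooth_has_dz[OF dr_inv_Cc_smooth[OF w0] \<open>0 \<le> r\<close>])
  have "(?g has_real_derivative 1 + t * \<phi>') (at y)"
    unfolding flow_map_def using \<phi>' by (auto intro!: derivative_eq_intros)
  from DERIV_chain2[OF Cc_smooth_has_dz[OF \<Phi>_Cc_smooth[OF t] \<open>0 \<le> r\<close>] this]
  have "(dr_inv w0 r has_real_derivative
      dz (\<lambda>r z. \<Phi> r z t) r (?g y) * (1 + t * \<phi>')) (at y)"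
    by (simp add: \<Phi>_constant_along_characteristics[OF assms])
  with \<phi>' have "\<phi>' = dz (\<lambda>r z. \<Phi> r z t) r (?g y) * (1 + t * \<phi>')"
    by (rule DERIV_unique)
  \<comment> \<open>A vanishing Jacobian makes the right-hand side zero, so
    \<open>\<phi>' = 0\<close>, and then the Jacobian would be 1.\<close>
  with J show False by (simp add: \<phi>'_def)
qed

end

text \<open>Far outside the support the map is the identity, and continuity fills in the values
  between. The argument is independent of the Jacobian, so uniqueness rests only on the
  characteristics covering the line.\<close>

lemma surj_flow_map:
  assumes "\<phi> \<in> Cc_smooth" "0 \<le> r"
  shows "surj (flow_map \<phi> r t)"
  unfolding surj_def
proof
  fix z :: real
  obtain R Z where "Z > 0" and Z: "vanishes_outside R Z \<phi>"
    using assms(1) by (auto simp: Cc_smooth_iff)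
  let ?g = "flow_map \<phi> r t" and ?M = "\<bar>z\<bar> + Z + 1"
  have "?g ?M = ?M" "?g (- ?M) = - ?M"
    using Z \<open>0 \<le> r\<close> \<open>Z > 0\<close> by (auto simp: flow_map_def vanishes_outside_def)
  moreover have "continuous_on {- ?M..?M} ?g"
    unfolding flow_map_def
    using DERIV_isCont[OF Cc_smooth_has_dz[OF assms]]
    by (intro continuous_intros continuous_at_imp_continuous_on) auto
  ultimately obtain y where "?g y = z"
    using IVT'[of ?g "- ?M" z ?M] \<open>Z > 0\<close> by (auto simp: abs_real_def split: if_splits)
  then show "\<exists>y. z = ?g y" by blast
qed

lemma strong_solution_unique:
  assumes w0: "w0 \<in> Cc_smooth" and w: "strong_solution w0 T w" "strong_solution w0 T w'"
    and r: "0 \<le> r" and t: "t \<in> times_below T"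
  shows "w r z t = w' r z t"
proof -
  interpret w: vorticity_solution w0 T w by unfold_locales (fact w0 w)+
  interpret w': vorticity_solution w0 T w' by unfold_locales (fact w0 w)+
  \<comment> \<open>Equality is established at all radii, because the vorticity is recovered by
    differentiating in \<open>\<rho>\<close>.\<close>
  have eq: "w.\<Phi> \<rho> y t = w'.\<Phi> \<rho> y t" if "0 \<le> \<rho>" for \<rho> y
    using surjD[OF surj_flow_map[OF dr_inv_Cc_smooth[OF w0] that], of y t]
      w.\<Phi>_constant_along_characteristics[OF t that] w'.\<Phi>_constant_along_characteristics[OF t that]
    by metis
  have "((\<lambda>\<rho>. w.\<Phi> \<rho> z t) has_derivative (*) (w r z t)) (at r within {0..})"
    using dr_inv_has_dr[OF w.slice_Cc_smooth[OF t] r]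
    by (simp add: w.\<Phi>_def has_field_derivative_def)
  moreover have "((\<lambda>\<rho>. w'.\<Phi> \<rho> z t) has_derivative (*) (w' r z t)) (at r within {0..})"
    using dr_inv_has_dr[OF w'.slice_Cc_smooth[OF t] r]
    by (simp add: w'.\<Phi>_def has_field_derivative_def)
  then have "((\<lambda>\<rho>. w.\<Phi> \<rho> z t) has_derivative (*) (w' r z t)) (at r within {0..})"
    by (rule has_derivative_transform[rotated -1]) (use r eq in auto)
  ultimately have "(*) (w r z t) = (*) (w' r z t)"
    using frechet_derivative_within_eq[OF axis_accessible_half_line] r by (metis atLeast_iff)
  from fun_cong[OF this, of 1] show ?thesis by simp
qed

section \<open>Construction of the solution\<close>

lemma Cc_smooth_gradient:
  assumes "u \<in> Cc_smooth" "0 \<le> r"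
  shows "((\<lambda>(r, z). u r z) has_derivative (\<lambda>(a, b). a * dir_deriv (1, 0) u r z + b * dz u r z))
    (at (r, z) within half_plane)"
proof -
  note D = Cc_smooth_has_derivative[OF assms, of z]
  interpret D: bounded_linear "\<lambda>v. dir_deriv v u r z"
    using D by (rule has_derivative_bounded_linear)
  have eq: "dir_deriv (a, b) u r z = a * dir_deriv (1, 0) u r z + b * dz u r z" for a b
  proof -
    have "dir_deriv (a, b) u r z = dir_deriv (a *\<^sub>R (1, 0) + b *\<^sub>R (0, 1)) u r z" by simp
    also have "\<dots> = a * dir_deriv (1, 0) u r z + b * dz u r z"
      by (simp only: D.add D.scaleR real_scaleR_def dz_eq_dir_deriv[OF assms])
    finally show ?thesis .
  qed
  have "(\<lambda>v. dir_deriv v u r z) = (\<lambda>(a, b). a * dir_deriv (1, 0) u r z + b * dz u r z)"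
  proof
    fix v :: "real \<times> real"
    obtain a b where v: "v = (a, b)" by (cases v)
    show "dir_deriv v u r z = (\<lambda>(a, b). a * dir_deriv (1, 0) u r z + b * dz u r z) v"
      unfolding v prod.case by (rule eq)
  qed
  with D show ?thesis by (simp only:)
qed

text \<open>Uniqueness of the one-sided derivative identifies the radial component as
  \<open>u\<close> itself. In this way \<open>w0\<close> enters the system for the labels without
  being differentiated.\<close>

lemma dr_inv_gradient:
  assumes "u \<in> Cc_smooth" "0 \<le> r"
  shows "((\<lambda>(r, z). dr_inv u r z) has_derivative (\<lambda>(a, b). a * u r z + b * dz (dr_inv u) r z))
    (at (r, z) within half_plane)"
proof -
  note D = Cc_smooth_gradient[OF dr_inv_Cc_smooth[OF assms(1)] assms(2), of z]
  have "((\<lambda>\<rho>. dr_inv u \<rho> z) has_derivative (*) (u r z)) (at r within {0..})"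
    "((\<lambda>\<rho>. dr_inv u \<rho> z) has_derivative (*) (dir_deriv (1, 0) (dr_inv u) r z)) (at r within {0..})"
    using dr_inv_has_dr[OF assms] slice_derivatives(2)[OF D assms(2)]
    by (simp_all add: has_field_derivative_def)
  then have "(*) (dir_deriv (1, 0) (dr_inv u) r z) = (*) (u r z)"
    using frechet_derivative_within_eq[OF axis_accessible_half_line] assms(2) by (metis atLeast_iff)
  from fun_cong[OF this, of 1] D show ?thesis by simp
qed

lemma smooth_on_space_time_lift:
  assumes "u \<in> Cc_smooth"
  shows "smooth_on (space_time T) (\<lambda>(r, z, t). u r z)"
proof -
  have "smooth_on (space_time T) (\<lambda>p. (\<lambda>(r, z). u r z) ((fst p, fst (snd p)) + 0))"
    using assms
    by (intro smooth_on_compose_affine[where B = half_plane and L = "\<lambda>p. (fst p, fst (snd p))"]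
        axis_accessible_half_plane axis_accessible_space_time bounded_linear_Pair
        bounded_linear_fst bounded_linear_fst_comp bounded_linear_snd) (auto simp: Cc_smooth_iff)
  then show ?thesis by (simp add: case_prod_beta')
qed

text \<open>Existence is shown on any horizon with positive Jacobian; the horizon given by the
  infimum is inserted afterwards.\<close>

locale characteristic_flow =
  fixes w0 :: "real \<Rightarrow> real \<Rightarrow> real" and T :: ereal
  assumes w0: "w0 \<in> Cc_smooth" and T_pos: "0 < T"
    and jacobian_pos: "\<And>r y t. 0 \<le> r \<Longrightarrow> t \<in> times_below T \<Longrightarrow> 0 < 1 + t * dz (dr_inv w0) r y"
begin

abbreviation \<phi> :: "real \<Rightarrow> real \<Rightarrow> real" where
  "\<phi> \<equiv> dr_inv w0"

definition h :: "real \<Rightarrow> real \<Rightarrow> real \<Rightarrow> real" where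
  "h r z t = back_to_labels \<phi> r z t"

text \<open>The derivative of \<open>flow_map\<close> in its last argument; \<open>y\<close> is a
  label, not a position.\<close>

definition J :: "real \<Rightarrow> real \<Rightarrow> real \<Rightarrow> real" where
  "J r y t = 1 + t * dz \<phi> r y"

definition W :: "real \<Rightarrow> real \<Rightarrow> real \<Rightarrow> real" where
  "W r z t = w0 r (h r z t) / J r (h r z t) t"

lemma \<phi>_Cc_smooth: "\<phi> \<in> Cc_smooth"
  by (rule dr_inv_Cc_smooth[OF w0])

lemma J_pos: "0 \<le> r \<Longrightarrow> t \<in> times_below T \<Longrightarrow> 0 < J r y t"
  unfolding J_def by (rule jacobian_pos)

lemma J_nonzero: "p \<in> space_time T \<Longrightarrow> (\<lambda>(r, y, t). J r y t) p \<noteq> 0"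
  using J_pos by (cases p) (auto simp: less_imp_neq[symmetric])

text \<open>A positive Jacobian makes the map strictly increasing. The equivalence also allows
  comparing \<open>h\<close> with constants, which yields its continuity.\<close>

lemma flow_map_less_iff:
  assumes "0 \<le> r" "t \<in> times_below T"
  shows "flow_map \<phi> r t y < flow_map \<phi> r t y' \<longleftrightarrow> y < y'"
proof -
  have deriv: "(flow_map \<phi> r t has_real_derivative J r y t) (at y)" for y
    unfolding flow_map_def J_def using Cc_smooth_has_dz[OF \<phi>_Cc_smooth assms(1)]
    by (auto intro!: derivative_eq_intros)
  have "flow_map \<phi> r t y < flow_map \<phi> r t y'" if "y < y'" for y y'
    using that
  proof (rule DERIV_pos_imp_increasing)
    show "\<exists>d. (flow_map \<phi> r t has_real_derivative d) (at x) \<and> 0 < d" for x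
      using deriv[of x] J_pos[OF assms, of x] by blast
  qed
  from this[of y y'] this[of y' y] show ?thesis
    by (cases y y' rule: linorder_cases) auto
qed

lemma bij_flow_map:
  assumes "0 \<le> r" "t \<in> times_below T"
  shows "bij (flow_map \<phi> r t)"
proof -
  have "inj (flow_map \<phi> r t)"
    using flow_map_less_iff[OF assms] by (metis injI less_irrefl linorder_less_linear)
  then show ?thesis
    using surj_flow_map[OF \<phi>_Cc_smooth assms(1)] by (simp add: bij_def)
qed

lemma
  assumes "0 \<le> r" "t \<in> times_below T"
  shows flow_map_h: "flow_map \<phi> r t (h r z t) = z"
    and h_flow_map: "h r (flow_map \<phi> r t y) t = y"
  using bij_flow_map[OF assms]
  by (simp_all add: h_def back_to_labels_def bij_is_surj surj_f_inv_f bij_is_inj inv_f_f)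

text \<open>By monotonicity \<open>a < h r z t\<close> holds exactly where
  \<open>flow_map \<phi> r t a < z\<close>, a relatively open condition on \<open>(r, z, t)\<close>,
  and likewise for the reverse inequality. Joint continuity then follows from the order
  topology.\<close>

lemma continuous_h:
  assumes p: "(r, z, t) \<in> space_time T"
  shows "((\<lambda>(r, z, t). h r z t) \<longlongrightarrow> h r z t) (at (r, z, t) within space_time T)"
proof -
  define F where "F a = (\<lambda>(r, z, t). z - flow_map \<phi> r t a)" for a
  have F: "(F a \<longlongrightarrow> F a (r, z, t)) (at (r, z, t) within space_time T)" for a
  proof -
    have "continuous_on (space_time T) (\<lambda>p. (\<lambda>(r, z). \<phi> r z) (fst p, a))"
      by (rule continuous_on_compose2[of half_plane "\<lambda>(r, z). \<phi> r z"])
         (use \<phi>_Cc_smooth in \<open>auto simp: Cc_smooth_iff smooth_on_continuous intro!: continuous_intros\<close>)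
    then have "continuous_on (space_time T) (F a)"
      unfolding F_def flow_map_def case_prod_beta' by (auto intro!: continuous_intros)
    with p show ?thesis unfolding continuous_on_def by blast
  qed
  have F_iff: "0 < F a (r, z, t) \<longleftrightarrow> a < h r z t" "F a (r, z, t) < 0 \<longleftrightarrow> h r z t < a"
    if "(r, z, t) \<in> space_time T" for a r z t
    using that flow_map_less_iff[of r t a "h r z t"] flow_map_less_iff[of r t "h r z t" a]
      flow_map_h[of r t z] by (auto simp: F_def)
  have S: "\<forall>\<^sub>F q in at (r, z, t) within space_time T. q \<in> space_time T"
    by (simp add: eventually_at_filter)
  show ?thesis
  proof (rule order_tendstoI)
    fix a
    assume "a < h r z t"
    then have "0 < F a (r, z, t)" using F_iff(1)[OF p] by blast
    from order_tendstoD(1)[OF F this] S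
    show "\<forall>\<^sub>F q in at (r, z, t) within space_time T. a < (case q of (r, z, t) \<Rightarrow> h r z t)"
      by eventually_elim (use F_iff(1) in \<open>force split: prod.split\<close>)
  next
    fix a
    assume "h r z t < a"
    then have "F a (r, z, t) < 0" using F_iff(2)[OF p] by blast
    from order_tendstoD(2)[OF F this] S
    show "\<forall>\<^sub>F q in at (r, z, t) within space_time T. (case q of (r, z, t) \<Rightarrow> h r z t) < a"
      by eventually_elim (use F_iff(2) in \<open>force split: prod.split\<close>)
  qed
qed

definition H :: "real \<times> real \<times> real \<Rightarrow> real \<times> real \<times> real" where
  "H = (\<lambda>(r, z, t). (r, h r z t, t))"

text \<open>
  Inverting the derivative of \<open>(r, y, t) \<mapsto> (r, y + t \<phi>(r, y), t)\<close>, whose determinant is \<open>J\<close>,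
  gives \<open>DH = P \<circ> H\<close>.
\<close>

definition P :: "real \<times> real \<times> real \<Rightarrow> real \<times> real \<times> real \<Rightarrow> real \<times> real \<times> real" where
  "P = (\<lambda>(a, b, c) (r, y, t). (a, (b - t * w0 r y * a - \<phi> r y * c) / J r y t, c))"

text \<open>\<open>H\<close> inverts \<open>G\<close>, which keeps \<open>r\<close> and
  \<open>t\<close> and so maps \<open>space_time T\<close> onto itself. The derivative rule for
  inverses applies within this set, boundary included, from continuity of \<open>H\<close> and a
  left inverse of the derivative of \<open>G\<close>.\<close>

lemma H_has_derivative:
  assumes p: "p \<in> space_time T"
  shows "(H has_derivative (\<lambda>v. P v (H p))) (at p within space_time T)"
proof -
  define G where "G = (\<lambda>(r, y, t). (r, flow_map \<phi> r t y, t))"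
  have GH: "G (H q) = q" and HG: "H (G q) = q" and H_in: "H q \<in> space_time T"
    and G_in: "G q \<in> space_time T" if "q \<in> space_time T" for q
    using that flow_map_h h_flow_map by (auto simp: G_def H_def)
  have image: "G ` space_time T = space_time T"
    using GH H_in G_in by (metis (no_types, lifting) image_eqI image_subsetI subsetI subset_antisym)
  obtain r z t where p_eq: "p = (r, z, t)" by (cases p) auto
  define y where "y = h r z t"
  have r: "0 \<le> r" and t: "t \<in> times_below T" using p by (auto simp: p_eq)
  have Hp: "H p = (r, y, t)" by (simp add: H_def p_eq y_def)
  \<comment> \<open>The radial part of the middle component is \<open>w0\<close>, since
    \<open>\<phi>\<close> has radial derivative \<open>w0\<close>. Solving the middle component for
    \<open>b\<close> produces the quotient in \<open>P\<close>.\<close>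
  define G' where "G' = (\<lambda>(a, b, c). (a, b + ((a * w0 r y + b * dz \<phi> r y) * t + \<phi> r y * c), c :: real))"
  have "((\<lambda>q. (fst q, fst (snd q))) has_derivative (\<lambda>v. (fst v, fst (snd v))))
      (at (r, y, t) within space_time T)"
    by (intro derivative_intros)
  moreover have "((\<lambda>(r, z). \<phi> r z) has_derivative (\<lambda>(a, b). a * w0 r y + b * dz \<phi> r y))
      (at (fst (r, y, t), fst (snd (r, y, t))) within (\<lambda>q. (fst q, fst (snd q))) ` space_time T)"
    by (rule has_derivative_subset[where s = half_plane]) (use dr_inv_gradient[OF w0 r] in auto)
  ultimately have "((\<lambda>q. (\<lambda>(r, z). \<phi> r z) (fst q, fst (snd q))) has_derivative
      (\<lambda>v. (\<lambda>(a, b). a * w0 r y + b * dz \<phi> r y) (fst v, fst (snd v)))) (at (r, y, t) within space_time T)"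
    by (rule has_derivative_in_compose)
  then have "((\<lambda>q. \<phi> (fst q) (fst (snd q))) has_derivative
      (\<lambda>v. fst v * w0 r y + fst (snd v) * dz \<phi> r y)) (at (r, y, t) within space_time T)"
    by simp
  then have "(G has_derivative G') (at (H p) within space_time T)"
    unfolding Hp G_def G'_def flow_map_def case_prod_beta'
    by (auto intro!: derivative_eq_intros)
  moreover have "continuous (at (G (H p)) within G ` space_time T) H"
    using tendsto_Pair[OF tendsto_fst[OF tendsto_ident_at]
        tendsto_Pair[OF continuous_h tendsto_snd[OF tendsto_snd[OF tendsto_ident_at]]], of r z t] p
    unfolding image GH[OF p] continuous_within unfolding p_eq
    by (simp add: H_def case_prod_beta')
  moreover have "linear (\<lambda>v. P v (H p))"
    unfolding Hp P_def by (rule linearI) (auto simp: algebra_simps diff_divide_distrib add_divide_distrib)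
  moreover have "(\<lambda>v. P v (H p)) \<circ> G' = id"
    using J_pos[OF r t, of y] by (auto simp: Hp P_def G'_def J_def fun_eq_iff field_simps)
  ultimately have "(H has_derivative (\<lambda>v. P v (H p))) (at (G (H p)) within G ` space_time T)"
    using H_in[OF p] HG by (intro has_derivative_inverse_within[where f' = G']) auto
  then show ?thesis by (simp add: image GH[OF p])
qed

section \<open>Smoothness of the explicit solution up to \<open>r = 0\<close> and
  \<open>t = 0\<close>\<close>

lemma smooth_J: "smooth_on (space_time T) (\<lambda>(r, y, t). J r y t)"
proof -
  have "smooth_on (space_time T) (\<lambda>p. 1 + snd (snd p) * (\<lambda>(r, z, t). dz \<phi> r z) p)"
    by (intro smooth_on_add smooth_on_mult axis_accessible_space_time smooth_on_const
        smooth_on_linear bounded_linear_snd_comp bounded_linear_snd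
        smooth_on_space_time_lift dz_Cc_smooth \<phi>_Cc_smooth)
  then show ?thesis by (simp add: J_def case_prod_beta')
qed

lemma smooth_on_compose_H:
  fixes Q :: "real \<times> real \<times> real \<Rightarrow> real"
  assumes Q: "smooth_on (space_time T) Q"
  shows "smooth_on (space_time T) (\<lambda>p. Q (H p))"
proof (rule smooth_on_compose_autonomous[OF axis_accessible_space_time axis_accessible_space_time
      _ H_has_derivative _ Q])
  show "H p \<in> space_time T" if "p \<in> space_time T" for p
    using that by (auto simp: H_def)
  fix v i :: "real \<times> real \<times> real"
  assume i: "i \<in> Basis"
  obtain a b c where v: "v = (a, b, c)" by (cases v) auto
  note S = axis_accessible_space_time[of T]
  have time: "smooth_on (space_time T) (\<lambda>p. snd (snd p))"
    by (intro smooth_on_linear S bounded_linear_snd_comp bounded_linear_snd)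
  \<comment> \<open>This is the middle component of \<open>P\<close>; the other two are the
    constants \<open>a\<close> and \<open>c\<close>. Differences are written as sums with a negative
    to match the closure rules.\<close>
  have "smooth_on (space_time T) (\<lambda>p. (b + - (snd (snd p) * (\<lambda>(r, z, t). w0 r z) p * a)
      + - ((\<lambda>(r, z, t). \<phi> r z) p * c)) / (\<lambda>(r, y, t). J r y t) p)"
    by (intro smooth_on_divide[OF S _ smooth_J] smooth_on_add[OF S] smooth_on_mult[OF S]
        smooth_on_minus[OF S] smooth_on_const[OF S] time
        smooth_on_space_time_lift w0 \<phi>_Cc_smooth)
       (rule J_nonzero)
  then show "smooth_on (space_time T) (\<lambda>q. P v q \<bullet> i)"
    using i smooth_on_const[OF S]
    by (auto simp: Basis_prod_def P_def v case_prod_beta' algebra_simps)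
qed

text \<open>In label coordinates the solution is the quotient of \<open>w0\<close> by
  \<open>J\<close>; composing with \<open>H\<close> returns to positions.\<close>

lemma smooth_W: "smooth_on (space_time T) (\<lambda>(r, z, t). W r z t)"
proof -
  have "smooth_on (space_time T) (\<lambda>p. (\<lambda>(r, z, t). w0 r z) p / (\<lambda>(r, y, t). J r y t) p)"
    by (intro smooth_on_divide axis_accessible_space_time smooth_on_space_time_lift w0 smooth_J)
       (rule J_nonzero)
  from smooth_on_compose_H[OF this] show ?thesis
    by (simp add: W_def H_def case_prod_beta')
qed

section \<open>Verification of the equation for the explicit formula\<close>

lemma
  assumes "0 \<le> r" "t \<in> times_below T"
  shows h_has_dr: "((\<lambda>r. h r z t) has_real_derivative - t * w0 r (h r z t) / J r (h r z t) t) (at r within {0..})"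
    and h_has_dz: "((\<lambda>z. h r z t) has_real_derivative 1 / J r (h r z t) t) (at z)"
    and h_has_dt: "((\<lambda>t. h r z t) has_real_derivative - \<phi> r (h r z t) / J r (h r z t) t)
      (at t within times_below T)"
proof -
  have p: "(r, z, t) \<in> space_time T" using assms by simp
  have "((\<lambda>p. fst (snd (H p))) has_derivative (\<lambda>v. fst (snd (P v (H (r, z, t)))))) (at (r, z, t) within space_time T)"
    by (intro has_derivative_fst has_derivative_snd H_has_derivative p)
  then have D: "((\<lambda>(r, z, t). h r z t) has_derivative (\<lambda>v. fst (snd (P v (H (r, z, t))))))
      (at (r, z, t) within space_time T)"
    by (simp add: H_def case_prod_beta')
  show "((\<lambda>r. h r z t) has_real_derivative - t * w0 r (h r z t) / J r (h r z t) t) (at r within {0..})"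
    "((\<lambda>z. h r z t) has_real_derivative 1 / J r (h r z t) t) (at z)"
    "((\<lambda>t. h r z t) has_real_derivative - \<phi> r (h r z t) / J r (h r z t) t) (at t within times_below T)"
    using slice_derivatives3[OF D] assms by (simp_all add: H_def P_def)
qed

text \<open>A change of \<open>r\<close> also moves the label, at rate \<open>- t w0 / J\<close>.
  The total \<open>w0 - t w0 dz \<phi> / J\<close> equals \<open>w0 / J\<close> because
  \<open>J - t dz \<phi> = 1\<close>; this is the origin of the denominator in the solution
  formula.\<close>

lemma \<phi>_h_has_dr:
  assumes "0 \<le> r" "t \<in> times_below T"
  shows "((\<lambda>r. \<phi> r (h r z t)) has_real_derivative W r z t) (at r within {0..})"
proof -
  define y where "y = h r z t"
  define k where "k = - t * w0 r y / J r y t"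
  have "((\<lambda>\<rho>. (\<rho>, h \<rho> z t)) has_derivative (\<lambda>a. (a, k * a))) (at r within {0..})"
    using h_has_dr[OF assms, of z] unfolding has_field_derivative_def k_def y_def
    by (intro has_derivative_Pair has_derivative_ident)
  moreover have "((\<lambda>(r, z). \<phi> r z) has_derivative (\<lambda>(a, b). a * w0 r y + b * dz \<phi> r y))
      (at (r, h r z t) within (\<lambda>\<rho>. (\<rho>, h \<rho> z t)) ` {0..})"
    using dr_inv_gradient[OF w0 assms(1), of y] unfolding y_def[symmetric]
    by (rule has_derivative_subset) auto
  ultimately have "((\<lambda>\<rho>. (\<lambda>(r, z). \<phi> r z) (\<rho>, h \<rho> z t)) has_derivative
      (\<lambda>a. (\<lambda>(a, b). a * w0 r y + b * dz \<phi> r y) (a, k * a))) (at r within {0..})"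
    by (rule has_derivative_in_compose)
  moreover have "a * w0 r y + k * a * dz \<phi> r y = W r z t * a" for a
    using J_pos[OF assms, of y] by (simp add: k_def W_def y_def[symmetric] field_simps J_def)
  ultimately show ?thesis by (simp add: has_field_derivative_def)
qed

lemma h_outside_support:
  assumes "vanishes_outside R Z w0" "0 \<le> r" "t \<in> times_below T" "R < r \<or> Z < \<bar>z\<bar>"
  shows "h r z t = z"
proof -
  have "\<phi> r z = 0"
    using vanishes_outside_dr_inv[OF assms(1)] assms(2,4) unfolding vanishes_outside_def by blast
  then show ?thesis
    using h_flow_map[OF assms(2,3), of z] by (simp add: flow_map_def)
qed

text \<open>\<open>\<phi>\<close> at the label is a radial antiderivative of \<open>W\<close>, and
  it vanishes for \<open>\<rho> > R\<close> whatever the label is.\<close>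

lemma dr_inv_W:
  assumes "0 \<le> r" "t \<in> times_below T"
  shows "dr_inv (\<lambda>r z. W r z t) r z = \<phi> r (h r z t)"
proof -
  obtain R Z where R: "R > 0" "vanishes_outside R Z w0"
    using w0 by (auto simp: Cc_smooth_iff)
  show ?thesis
  proof (rule dr_inv_eqI[where F = "\<lambda>r. \<phi> r (h r z t)"])
    show "((\<lambda>r. \<phi> r (h r z t)) has_real_derivative W \<rho> z t) (at \<rho> within {r..})" if "r \<le> \<rho>" for \<rho>
      by (rule has_field_derivative_subset[OF \<phi>_h_has_dr]) (use assms that in auto)
    show "\<phi> \<rho> (h \<rho> z t) = 0" if "\<rho> > R" for \<rho>
      using vanishes_outside_dr_inv[OF R(2)] that R(1) by (simp add: vanishes_outside_def)
  qed
qed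

text \<open>With \<open>w0\<close> and \<open>\<phi>\<close> taken at the label, time derivative
  plus transport give \<open>- w0 dz \<phi> / j^2\<close>: the terms with \<open>dz w0\<close> and
  with second derivatives of \<open>\<phi>\<close> cancel. The remaining term is the product of
  \<open>w0 / j\<close> and \<open>dz \<phi> / j\<close>.\<close>

lemma vorticity_equation:
  assumes r: "0 \<le> r" and t: "t \<in> times_below T"
  shows "vector_derivative (\<lambda>s. W r z s) (at t within times_below T)
    + dr_inv (\<lambda>r z. W r z t) r z * dz (\<lambda>r z. W r z t) r z
    + W r z t * dz (dr_inv (\<lambda>r z. W r z t)) r z = 0"
proof -
  define y where "y = h r z t"
  define j where "j = J r y t"
  have j: "j > 0" unfolding j_def by (rule J_pos[OF r t])
  have j_eq: "j = 1 + t * dz \<phi> r y" by (simp add: j_def J_def)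
  have hz: "((\<lambda>z. h r z t) has_real_derivative 1 / j) (at z)"
    using h_has_dz[OF r t, of z] by (simp add: j_def y_def)
  have ht: "((\<lambda>t. h r z t) has_real_derivative - \<phi> r y / j) (at t within times_below T)"
    using h_has_dt[OF r t, of z] by (simp add: j_def y_def)
  have du: "(u r has_real_derivative dz u r y) (at (h r z t))" if "u \<in> Cc_smooth" for u
    unfolding y_def by (rule Cc_smooth_has_dz[OF that r])
  have dz_comp: "((\<lambda>z. u r (h r z t)) has_real_derivative dz u r y * (1 / j)) (at z)"
    if "u \<in> Cc_smooth" for u
    by (rule DERIV_chain2[where f = "u r" and g = "\<lambda>z. h r z t", OF du[OF that] hz])
  have dt_comp: "((\<lambda>t. u r (h r z t)) has_real_derivative dz u r y * (- \<phi> r y / j)) (at t within times_below T)"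
    if "u \<in> Cc_smooth" for u
    by (rule DERIV_chain2[where f = "u r" and g = "\<lambda>t. h r z t", OF du[OF that] ht])
  note dz_h = dz_comp[OF w0] dz_comp[OF \<phi>_Cc_smooth] dz_comp[OF dz_Cc_smooth[OF \<phi>_Cc_smooth]]
    and dt_h = dt_comp[OF w0] dt_comp[OF dz_Cc_smooth[OF \<phi>_Cc_smooth]]
  have "((\<lambda>z. W r z t) has_real_derivative
      (dz w0 r y * (1 / j) * j - w0 r y * (t * (dz (dz \<phi>) r y * (1 / j)))) / (j * j)) (at z)"
    unfolding W_def J_def
    by (rule DERIV_divide[THEN DERIV_cong, OF dz_h(1) DERIV_add[OF DERIV_const DERIV_cmult[OF dz_h(3)]]])
       (use j in \<open>auto simp: j_eq y_def[symmetric]\<close>)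
  then have Wz: "dz (\<lambda>r z. W r z t) r z =
      (dz w0 r y * (1 / j) * j - w0 r y * (t * (dz (dz \<phi>) r y * (1 / j)))) / (j * j)"
    unfolding dz_def[of "\<lambda>r z. W r z t"] by (rule DERIV_imp_deriv)
  have "((\<lambda>s. W r z s) has_real_derivative
      (dz w0 r y * (- \<phi> r y / j) * j
        - w0 r y * (dz \<phi> r y + t * (dz (dz \<phi>) r y * (- \<phi> r y / j)))) / (j * j)) (at t within times_below T)"
    unfolding W_def J_def
    by (rule DERIV_divide[THEN DERIV_cong, OF dt_h(1) DERIV_add[OF DERIV_const DERIV_mult[OF DERIV_ident dt_h(2)]]])
       (use j in \<open>auto simp: j_eq y_def[symmetric] algebra_simps\<close>)
  then have Wt: "vector_derivative (\<lambda>s. W r z s) (at t within times_below T) =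
      (dz w0 r y * (- \<phi> r y / j) * j
        - w0 r y * (dz \<phi> r y + t * (dz (dz \<phi>) r y * (- \<phi> r y / j)))) / (j * j)"
    using at_within_times_below_nontrivial[OF t]
    by (intro vector_derivative_within) (auto simp: has_real_derivative_iff_has_vector_derivative)
  have "(dr_inv (\<lambda>r z. W r z t) r) = (\<lambda>z. \<phi> r (h r z t))"
    using dr_inv_W[OF r t] by auto
  then have \<phi>z: "dz (dr_inv (\<lambda>r z. W r z t)) r z = dz \<phi> r y * (1 / j)"
    unfolding dz_def[of "dr_inv (\<lambda>r z. W r z t)"] using DERIV_imp_deriv[OF dz_h(2)] by simp
  have "W r z t = w0 r y / j" by (simp add: W_def j_def y_def)
  then show ?thesis
    unfolding Wz Wt \<phi>z dr_inv_W[OF r t] y_def[symmetric] using j by (simp add: field_simps)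
qed

lemma strong_solution_W: "strong_solution w0 T W"
  unfolding strong_solution_def Let_def
proof (intro conjI allI impI ballI T_pos vorticity_equation)
  obtain R Z where R: "R > 0" "Z > 0" "vanishes_outside R Z w0"
    using w0 by (auto simp: Cc_smooth_iff)
  \<comment> \<open>Outside the box of \<open>w0\<close> labels do not move, so this one box serves
    all times, as \<open>smooth_curve_Cc\<close> asks.\<close>
  have "vanishes_outside R Z (\<lambda>r z. W r z t)" if "t \<in> times_below T" for t
    using R(3) h_outside_support[OF R(3) _ that] by (auto simp: vanishes_outside_def W_def)
  then show "smooth_curve_Cc T W"
    unfolding smooth_curve_Cc_def vanishes_outside_iff[symmetric]
    using smooth_W R(1,2) times_below_downward by (metis atLeastAtMost_iff)
next
  fix r z :: real
  assume "0 \<le> r"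
  then have "h r z 0 = z"
    using h_flow_map[of r 0 z] zero_in_times_below[OF T_pos] by (simp add: flow_map_def)
  then show "W r z 0 = w0 r z" by (simp add: W_def J_def)
qed

end

section \<open>The blowup time\<close>

lemma Cc_smooth_bounded:
  assumes "w \<in> Cc_smooth"
  obtains B where "\<And>r z. 0 \<le> r \<Longrightarrow> \<bar>w r z\<bar> \<le> B"
proof -
  obtain R Z where R: "vanishes_outside R Z w" and w: "smooth_on half_plane (\<lambda>(r, z). w r z)"
    using assms by (auto simp: Cc_smooth_iff)
  have "compact ((\<lambda>(r, z). w r z) ` ({0..R} \<times> {-Z..Z}))"
    by (intro compact_continuous_image compact_Times compact_Icc
        continuous_on_subset[OF smooth_on_continuous[OF w]]) auto
  then have "bounded ((\<lambda>(r, z). w r z) ` ({0..R} \<times> {-Z..Z}))" by (rule compact_imp_bounded)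
  then obtain B where B: "\<And>x. x \<in> (\<lambda>(r, z). w r z) ` ({0..R} \<times> {-Z..Z}) \<Longrightarrow> \<bar>x\<bar> \<le> B"
    unfolding bounded_iff real_norm_def by blast
  \<comment> \<open>\<open>B\<close> bounds the values on the box only; the maximum with 0 covers
    the points off it.\<close>
  have "\<bar>w r z\<bar> \<le> max B 0" if "0 \<le> r" for r z
  proof (cases "R < r \<or> Z < \<bar>z\<bar>")
    case True
    then have "w r z = 0" using R that unfolding vanishes_outside_def by blast
    then show ?thesis by simp
  next
    case False
    then have "w r z \<in> (\<lambda>(r, z). w r z) ` ({0..R} \<times> {-Z..Z})"
      using that by (intro image_eqI[of _ _ "(r, z)"]) auto
    from B[OF this] show ?thesis by simp
  qed
  with that show thesis by blast
qed

abbreviation (input) inf_dz :: "(real \<Rightarrow> real \<Rightarrow> real) \<Rightarrow> ereal" where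
  "inf_dz \<phi> \<equiv> (INF (r, z)\<in>{0..} \<times> UNIV. ereal (dz \<phi> r z))"

text \<open>Boundedness of \<open>dz \<phi>\<close> makes the infimum real, and a point off the
  support, where \<open>dz \<phi>\<close> is 0, makes it nonpositive. The last conclusion supplies
  near-minimisers in place of a minimum point.\<close>

lemma inf_dz_finite:
  assumes "\<phi> \<in> Cc_smooth"
  obtains i where "inf_dz \<phi> = ereal i" "i \<le> 0"
    and "\<And>r z. 0 \<le> r \<Longrightarrow> i \<le> dz \<phi> r z"
    and "\<And>e. i < e \<Longrightarrow> \<exists>r\<ge>0. \<exists>z. dz \<phi> r z < e"
proof -
  obtain B where B: "\<And>r z. 0 \<le> r \<Longrightarrow> \<bar>dz \<phi> r z\<bar> \<le> B"
    using Cc_smooth_bounded[OF dz_Cc_smooth[OF assms]] by blast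
  have "ereal (- B) \<le> inf_dz \<phi>"
  proof (rule INF_greatest)
    fix p :: "real \<times> real"
    assume "p \<in> half_plane"
    then show "ereal (- B) \<le> (case p of (r, z) \<Rightarrow> ereal (dz \<phi> r z))"
      using B[of "fst p" "snd p"] by (auto simp: abs_le_iff)
  qed
  moreover obtain R Z where R: "R > 0" "vanishes_outside R Z (dz \<phi>)"
    using dz_Cc_smooth[OF assms] by (auto simp: Cc_smooth_iff)
  then have "dz \<phi> (R + 1) 0 = 0" by (simp add: vanishes_outside_def)
  with R have le0: "inf_dz \<phi> \<le> ereal 0"
    by (intro INF_lower2[of "(R + 1, 0)"]) auto
  ultimately obtain i where i: "inf_dz \<phi> = ereal i"
    by (cases "inf_dz \<phi>") auto
  show thesis
  proof (rule that[OF i])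
    show "i \<le> 0" using le0 i by simp
    show "i \<le> dz \<phi> r z" if "0 \<le> r" for r z
      using INF_lower[of "(r, z)" half_plane "\<lambda>(r, z). ereal (dz \<phi> r z)"] that i by simp
    show "\<exists>r\<ge>0. \<exists>z. dz \<phi> r z < e" if "i < e" for e
    proof -
      have "inf_dz \<phi> < ereal e" using i that by simp
      then show ?thesis unfolding INF_less_iff by auto
    qed
  qed
qed

text \<open>For \<open>i = 0\<close> the quotient is infinite in \<open>ereal\<close>, so the
  equivalence with a positive Jacobian bound also covers global existence.\<close>

lemma times_below_blowup_time:
  assumes "i \<le> 0"
  shows "0 < 1 / (- ereal i)"
    and "t \<in> times_below (1 / (- ereal i)) \<longleftrightarrow> 0 \<le> t \<and> 0 < 1 + t * i"
proof -
  have "0 < 1 / (- ereal i) \<and>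
    (t \<in> times_below (1 / (- ereal i)) \<longleftrightarrow> 0 \<le> t \<and> 0 < 1 + t * i)"
  proof (cases "i = 0")
    case True
    have "1 / (- ereal i) = \<infinity>" by (simp add: True divide_ereal_def)
    then show ?thesis unfolding \<open>1 / (- ereal i) = \<infinity>\<close> by (simp add: times_below_def True)
  next
    case False
    with assms have "1 / (- ereal i) = ereal (1 / (- i))" "i < 0"
      by (simp_all add: one_ereal_def)
    then show ?thesis by (auto simp: times_below_def field_simps)
  qed
  then show "0 < 1 / (- ereal i)"
    "t \<in> times_below (1 / (- ereal i)) \<longleftrightarrow> 0 \<le> t \<and> 0 < 1 + t * i" by auto
qed

text \<open>A solution outliving the bound would be defined at some \<open>t\<close> strictly beyond
  it. The strict inequality leaves room for a near-minimiser with slope below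
  \<open>- (1 / t)\<close>, and at that point the Jacobian vanishes no later than
  \<open>t\<close>.\<close>

lemma strong_solution_imp_le_blowup_time:
  assumes w0: "w0 \<in> Cc_smooth" and "strong_solution w0 T w"
  shows "T \<le> 1 / (- inf_dz (dr_inv w0))"
proof (rule ccontr)
  interpret vorticity_solution w0 T w by unfold_locales (fact assms)+
  obtain i where I: "inf_dz (dr_inv w0) = ereal i" "i \<le> 0"
    and approx: "\<And>e. i < e \<Longrightarrow> \<exists>r\<ge>0. \<exists>z. dz (dr_inv w0) r z < e"
    using inf_dz_finite[OF dr_inv_Cc_smooth[OF w0]] by metis
  assume "\<not> T \<le> 1 / (- inf_dz (dr_inv w0))"
  then have "1 / (- ereal i) < T" using I by simp
  then obtain t where t: "1 / (- ereal i) < ereal t" "ereal t < T" using ereal_dense2 by blast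
  then have "0 < t" using times_below_blowup_time(1)[OF I(2)] by (metis ereal_less(2) less_trans)
  moreover have "t \<notin> times_below (1 / (- ereal i))"
    using t(1) unfolding times_below_def by (blast dest: less_asym)
  ultimately have "1 + t * i \<le> 0"
    using times_below_blowup_time(2)[OF I(2), of t] by simp
  then have "i < 0" using mult_nonneg_nonneg[of t i] \<open>0 < t\<close> by (cases "i = 0") (use I in auto)
  have "1 / (- ereal i) = ereal (1 / (- i))"
    using \<open>i < 0\<close> by (simp add: one_ereal_def)
  with t(1) have "1 / (- i) < t" by simp
  then have "i < - (1 / t)" using \<open>i < 0\<close> \<open>0 < t\<close> by (simp add: field_simps)
  then obtain r z where r: "0 \<le> r" and d: "dz (dr_inv w0) r z < - (1 / t)"
    using approx by blast
  \<comment> \<open>The zero in time of the Jacobian at the chosen point.\<close>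
  define s where "s = - (1 / dz (dr_inv w0) r z)"
  have neg: "dz (dr_inv w0) r z < 0" using d \<open>0 < t\<close> by (smt (verit) divide_pos_pos)
  have "0 \<le> s" "s \<le> t" using d neg \<open>0 < t\<close> by (auto simp: s_def field_simps)
  moreover have "t \<in> times_below T" using t \<open>0 < t\<close> by (simp add: times_below_def)
  ultimately have "s \<in> times_below T" using times_below_downward by blast
  from jacobian_nonzero[OF this r, of z] neg show False by (simp add: s_def)
qed

text \<open>Every slope is at least \<open>i\<close>, so at times \<open>t \<ge> 0\<close> the
  Jacobian is at least \<open>1 + t * i\<close>, which is positive before the blowup time.\<close>

lemma characteristic_flow_blowup_time:
  assumes "w0 \<in> Cc_smooth"
  shows "characteristic_flow w0 (1 / (- inf_dz (dr_inv w0)))"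
proof -
  obtain i where I: "inf_dz (dr_inv w0) = ereal i" "i \<le> 0"
    and lower: "\<And>r z. 0 \<le> r \<Longrightarrow> i \<le> dz (dr_inv w0) r z"
    using inf_dz_finite[OF dr_inv_Cc_smooth[OF assms]] by metis
  show ?thesis
    unfolding I(1)
  proof
    show "0 < 1 + t * dz (dr_inv w0) r y" if "0 \<le> r" "t \<in> times_below (1 / (- ereal i))" for r y t
    proof -
      have "0 \<le> t" "0 < 1 + t * i"
        using that(2) times_below_blowup_time(2)[OF I(2)] by auto
      then show ?thesis using mult_left_mono[OF lower[OF that(1), of y], of t] by linarith
    qed
  qed (use assms times_below_blowup_time(1)[OF I(2)] in auto)
qed

text \<open>\<open>W\<close> lives on the whole half-open interval up to the blowup time, so the
  supremum is attained, for zero data as well.\<close>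

lemma T_max_eq:
  assumes "w0 \<in> Cc_smooth"
  shows "T_max w0 = 1 / (- inf_dz (dr_inv w0))"
  unfolding T_max_def
proof (rule Sup_eqI)
  interpret characteristic_flow w0 "1 / (- inf_dz (dr_inv w0))"
    by (rule characteristic_flow_blowup_time[OF assms])
  show "1 / (- inf_dz (dr_inv w0)) \<le> T" if "\<And>S. S \<in> {T. \<exists>w. strong_solution w0 T w} \<Longrightarrow> S \<le> T" for T
    using that strong_solution_W by blast
qed (use strong_solution_imp_le_blowup_time[OF assms] in blast)

text \<open>A slice that vanishes at both ends and is nonzero in between must decrease on one side:
  before \<open>z\<close> if the value there is negative, after \<open>z\<close> if it is positive.
  The mean value theorem locates such a point.\<close>

lemma exists_negative_dz:
  assumes "\<phi> \<in> Cc_smooth" "0 \<le> r" "\<phi> r z \<noteq> 0"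
  shows "\<exists>y. dz \<phi> r y < 0"
proof -
  obtain R Z where R: "vanishes_outside R Z \<phi>" using assms(1) by (auto simp: Cc_smooth_iff)
  define b where "b = \<bar>Z\<bar> + \<bar>z\<bar> + 1"
  have "Z < \<bar>b\<bar>" "Z < \<bar>- b\<bar>" by (auto simp: b_def)
  then have ends: "\<phi> r b = 0" "\<phi> r (- b) = 0"
    using R assms(2) unfolding vanishes_outside_def by blast+
  have less: "- b < z" "z < b" by (auto simp: b_def)
  note deriv = Cc_smooth_has_dz[OF assms(1,2)]
  obtain y1 y2 where y: "\<phi> r z - \<phi> r (- b) = (z + b) * dz \<phi> r y1" "\<phi> r b - \<phi> r z = (b - z) * dz \<phi> r y2"
    using MVT2[OF less(1), of "\<phi> r" "dz \<phi> r"] MVT2[OF less(2), of "\<phi> r" "dz \<phi> r"] deriv by auto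
  show ?thesis
  proof (cases "\<phi> r z < 0")
    case True
    then have "(z + b) * dz \<phi> r y1 < 0" using y(1) ends by simp
    then show ?thesis using less by (auto simp: mult_less_0_iff)
  next
    case False
    then have "(b - z) * dz \<phi> r y2 < 0" using y(2) ends assms(3) by simp
    then show ?thesis using less by (auto simp: mult_less_0_iff)
  qed
qed

text \<open>If the velocity vanished along the whole radial line through the point, its radial
  derivative \<open>w0 r z\<close> would be 0. So some slice of the velocity is nonzero and has a
  negative slope, which forces \<open>i < 0\<close>.\<close>

lemma blowup_time_finite:
  assumes "w0 \<in> Cc_smooth" "0 \<le> r" "w0 r z \<noteq> 0"
  shows "1 / (- inf_dz (dr_inv w0)) < \<infinity>"
proof -
  note \<phi> = dr_inv_Cc_smooth[OF assms(1)]
  have "\<exists>\<rho>\<ge>0. dr_inv w0 \<rho> z \<noteq> 0"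
  proof (rule ccontr)
    assume *: "\<not> (\<exists>\<rho>\<ge>0. dr_inv w0 \<rho> z \<noteq> 0)"
    have "((\<lambda>\<rho>. dr_inv w0 \<rho> z) has_derivative (\<lambda>x. 0)) (at r within {0..})"
      by (rule has_derivative_transform[of r "{0..}" _ "\<lambda>_. 0"]) (use * assms(2) in auto)
    moreover have "((\<lambda>\<rho>. dr_inv w0 \<rho> z) has_derivative (*) (w0 r z)) (at r within {0..})"
      using dr_inv_has_dr[OF assms(1,2)] by (simp add: has_field_derivative_def)
    ultimately have "(*) (w0 r z) = (\<lambda>x. 0)"
      using frechet_derivative_within_eq[OF axis_accessible_half_line] assms(2) by (metis atLeast_iff)
    from fun_cong[OF this, of 1] assms(3) show False by simp
  qed
  then obtain \<rho> y where neg: "0 \<le> \<rho>" "dz (dr_inv w0) \<rho> y < 0"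
    using exists_negative_dz[OF \<phi>] by blast
  obtain i where I: "inf_dz (dr_inv w0) = ereal i"
    and lower: "\<And>r z. 0 \<le> r \<Longrightarrow> i \<le> dz (dr_inv w0) r z"
    using inf_dz_finite[OF \<phi>] by metis
  have "i < 0" using lower[OF neg(1), of y] neg(2) by simp
  then show ?thesis by (simp add: I one_ereal_def)
qed

theorem theorem1p1:
  fixes \<omega>0 \<phi>0 :: "real \<Rightarrow> real \<Rightarrow> real"
  assumes "\<omega>0 \<in> Cc_smooth"
    and "\<phi>0 = dr_inv \<omega>0"
  shows
    "(\<forall>r\<ge>0. \<forall>z. ((\<lambda>\<rho>. \<phi>0 \<rho> z) has_real_derivative \<omega>0 r z) (at r within {0..})) \<and>
     0 < T_max \<omega>0 \<and>
     (\<exists>\<omega>. strong_solution \<omega>0 (T_max \<omega>0) \<omega> \<and>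
        (\<forall>\<omega>'. strong_solution \<omega>0 (T_max \<omega>0) \<omega>' \<longrightarrow>
           (\<forall>r\<ge>0. \<forall>z. \<forall>t\<in>times_below (T_max \<omega>0). \<omega>' r z t = \<omega> r z t)) \<and>
        (\<forall>r\<ge>0. \<forall>z. \<forall>t\<in>times_below (T_max \<omega>0).
           let y = back_to_labels \<phi>0 r z t in
           bij (flow_map \<phi>0 r t) \<and>
           1 + t * dz \<phi>0 r y \<noteq> 0 \<and>
           \<omega> r z t = \<omega>0 r y / (1 + t * dz \<phi>0 r y))) \<and>
     ((\<exists>r\<ge>0. \<exists>z. \<omega>0 r z \<noteq> 0) \<longrightarrow>
        T_max \<omega>0 = 1 / (- (INF (r, z)\<in>{0..} \<times> UNIV. ereal (dz \<phi>0 r z))) \<and>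
        T_max \<omega>0 < \<infinity>)"
proof -
  note T = T_max_eq[OF assms(1)]
  \<comment> \<open>Since \<open>T_max\<close> equals the blowup time for all data, the Jacobian is
    positive on the whole maximal interval and \<open>W\<close> is the solution there.\<close>
  interpret characteristic_flow \<omega>0 "T_max \<omega>0"
    unfolding T by (rule characteristic_flow_blowup_time[OF assms(1)])
  have formula: "let y = back_to_labels \<phi>0 r z t in
      bij (flow_map \<phi>0 r t) \<and> 1 + t * dz \<phi>0 r y \<noteq> 0 \<and> W r z t = \<omega>0 r y / (1 + t * dz \<phi>0 r y)"
    if "0 \<le> r" "t \<in> times_below (T_max \<omega>0)" for r z t
    unfolding assms(2) Let_def
    using bij_flow_map[OF that] jacobian_pos[OF that] by (auto simp: W_def J_def h_def less_imp_neq[symmetric])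
  have unique: "\<omega>' r z t = W r z t"
    if "strong_solution \<omega>0 (T_max \<omega>0) \<omega>'" "0 \<le> r" "t \<in> times_below (T_max \<omega>0)" for \<omega>' r z t
    by (rule strong_solution_unique[OF assms(1) that(1) strong_solution_W that(2,3)])
  show ?thesis
  proof (intro conjI exI[of _ W])
    show "\<forall>r\<ge>0. \<forall>z. ((\<lambda>\<rho>. \<phi>0 \<rho> z) has_real_derivative \<omega>0 r z) (at r within {0..})"
      unfolding assms(2) using dr_inv_has_dr[OF assms(1)] by blast
    show "(\<exists>r\<ge>0. \<exists>z. \<omega>0 r z \<noteq> 0) \<longrightarrow>
        T_max \<omega>0 = 1 / (- (INF (r, z)\<in>{0..} \<times> UNIV. ereal (dz \<phi>0 r z))) \<and> T_max \<omega>0 < \<infinity>"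
      unfolding assms(2) T using blowup_time_finite[OF assms(1)] by blast
  qed (use T_pos strong_solution_W formula unique in blast)+
qed

end
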